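(* Let $r\geq 2$ be an integer, let $G_1,\dots,G_r$ be non-trivial finitely generated groups, and let $G=G_1\ast\cdots\ast G_r$ be their free product. For each $i=1,\dots,r$ let $S_i$ be a finite generating set of $G_i$, let $S=\bigcup_{i=1}^{r}S_i$, and let $\ell$ be the word length on $G$ determined by $S$. Let $\mu$ be a probability measure on $G$, and assume that its support generates a semigroup $\Gamma$ with the property that, for any $i\in\{1,\dots,r\}$, there is a non-trivial element $g\in\Gamma$ which neither starts nor ends in the factor $G_i$. If $(Y_n)_{n\geq 0}$ is a right random walk on $G$ with increments distributed according to $\mu$, then the sequence of random variables $\bigl(\frac{1}{n}\ell(Y_n)\bigr)_{n\geq 1}$ satisfies the weak large deviation principle with a convex rate function.
   Context: Word length: for a group $G$ with finite generating set $S$, $\ell(g)$ is the least $n\in\mathbb{N}$ such that $g=s_1\cdots s_n$ with $s_1,\dots,s_n\in S\cup S^{-1}$, and $\ell(e)=0$. Reduced words: each $G_i$ is identified with its copy in $G=G_1\ast\cdots\ast G_r$. Every non-trivial $g\in G$ can be written uniquely as $g=x_1\cdots x_m$ with $x_j\in G_{i_j}\setminus\{e\}$ and $i_j\neq i_{j+1}$ for $1\leq j\leq m-1$. Such a $g$ starts in the factor $G_i$ if $x_1\in G_i$, and ends in the factor $G_i$ if $x_m\in G_i$. Random walk: $Y_0=e$ and $Y_n=X_1\cdots X_n$ for $n\geq 1$, where $(X_n)_{n\geq 1}$ are independent $G$-valued random variables with common law $\mu$ on a probability space $(\Omega,\mathcal{F},\mathbb{P})$. The support of $\mu$ is $\{g\in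 G:\mu(g)>0\}$. Weak large deviation principle (conventions $\log 0=-\infty$, $\inf\emptyset=\infty$): let $(Z_n)_{n\geq 1}$ be random variables with values in a Hausdorff regular topological space $X$ (here $X=\mathbb{R}_{\geq 0}$), with laws $\mu_n$, and let $I\colon X\to[0,\infty]$ be lower semicontinuous. $(Z_n)$ satisfies the weak large deviation principle with rate function $I$ if $\liminf_{n}\frac{1}{n}\log\mu_n(V)\geq-\inf_{x\in V}I(x)$ for every open $V\subset X$ and $\limsup_{n}\frac{1}{n}\log\mu_n(K)\leq-\inf_{x\in K}I(x)$ for every compact $K\subset X$. *)

theory Defs
  imports "HOL-Algebra.Generated_Groups" "HOL-Probability.Probability"
begin

section \<open>Free products of groups\<close>

text \<open>
  The free product of a family \<open>G i\<close>, \<open>i \<in> I\<close>, is realised on its normal forms: the word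
  \<open>[(i\<^sub>1, x\<^sub>1), \<dots>, (i\<^sub>m, x\<^sub>m)]\<close> stands for \<open>x\<^sub>1 \<cdots> x\<^sub>m\<close> with \<open>x\<^sub>j\<close> a non-trivial element of the
  factor \<open>G i\<^sub>j\<close> and \<open>i\<^sub>j \<noteq> i\<^sub>j\<^sub>+\<^sub>1\<close>. The empty word is the identity.
\<close>

definition reduced_words :: "'i set \<Rightarrow> ('i \<Rightarrow> ('a, 'b) monoid_scheme) \<Rightarrow> ('i \<times> 'a) list set" where
  "reduced_words I G = {w. (\<forall>(i, x) \<in> set w. i \<in> I \<and> x \<in> carrier (G i) - {\<one>\<^bsub>G i\<^esub>}) \<and>
                           successively (\<lambda>(i, _) (j, _). i \<noteq> j) w}"

text \<open>Left multiplication of a reduced word by a single (possibly trivial) letter.\<close>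

fun letter_mult :: "('i \<Rightarrow> ('a, 'b) monoid_scheme) \<Rightarrow> 'i \<times> 'a \<Rightarrow> ('i \<times> 'a) list \<Rightarrow> ('i \<times> 'a) list" where
  "letter_mult G (i, x) [] = (if x = \<one>\<^bsub>G i\<^esub> then [] else [(i, x)])"
| "letter_mult G (i, x) ((j, y) # w) =
     (if x = \<one>\<^bsub>G i\<^esub> then (j, y) # w
      else if i \<noteq> j then (i, x) # (j, y) # w
      else if x \<otimes>\<^bsub>G i\<^esub> y = \<one>\<^bsub>G i\<^esub> then w
      else (i, x \<otimes>\<^bsub>G i\<^esub> y) # w)"

definition free_product :: "'i set \<Rightarrow> ('i \<Rightarrow> ('a, 'b) monoid_scheme) \<Rightarrow> ('i \<times> 'a) list monoid" where
  "free_product I G =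
     \<lparr>carrier = reduced_words I G, monoid.mult = (\<lambda>u v. foldr (letter_mult G) u v), one = []\<rparr>"

definition factor_embed :: "('i \<Rightarrow> ('a, 'b) monoid_scheme) \<Rightarrow> 'i \<Rightarrow> 'a \<Rightarrow> ('i \<times> 'a) list" where
  "factor_embed G i x = (if x = \<one>\<^bsub>G i\<^esub> then [] else [(i, x)])"

definition starts_in :: "'i \<Rightarrow> ('i \<times> 'a) list \<Rightarrow> bool" where
  "starts_in i w \<longleftrightarrow> w \<noteq> [] \<and> fst (hd w) = i"

definition ends_in :: "'i \<Rightarrow> ('i \<times> 'a) list \<Rightarrow> bool" where
  "ends_in i w \<longleftrightarrow> w \<noteq> [] \<and> fst (last w) = i"

subsection \<open>The construction is a group with the universal property of the free product\<close>

lemma free_product_simps [simp]: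
  "carrier (free_product I G) = reduced_words I G"
  "\<one>\<^bsub>free_product I G\<^esub> = []"
  "u \<otimes>\<^bsub>free_product I G\<^esub> v = foldr (letter_mult G) u v"
  by (simp_all add: free_product_def)

lemma reduced_words_Nil [simp]: "[] \<in> reduced_words I G"
  by (simp add: reduced_words_def)

lemma reduced_words_Cons:
  "(i, x) # w \<in> reduced_words I G \<longleftrightarrow>
     i \<in> I \<and> x \<in> carrier (G i) \<and> x \<noteq> \<one>\<^bsub>G i\<^esub> \<and> w \<in> reduced_words I G \<and> \<not> starts_in i w"
  by (cases w) (auto simp: reduced_words_def starts_in_def)

lemma letter_mult_one [simp]: "letter_mult G (i, \<one>\<^bsub>G i\<^esub>) w = w"
  by (cases w) auto

lemma letter_mult_eq_Cons:
  "(i, x) # w \<in> reduced_words I G \<Longrightarrow> letter_mult G (i, x) w = (i, x) # w"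
  by (cases w) (auto simp: reduced_words_Cons starts_in_def)

lemma letter_mult_closed:
  assumes "\<And>i. i \<in> I \<Longrightarrow> group (G i)" "i \<in> I" "x \<in> carrier (G i)" "w \<in> reduced_words I G"
  shows "letter_mult G (i, x) w \<in> reduced_words I G"
proof -
  interpret group "G i" by (rule assms)+
  show ?thesis
    using assms(2-) by (cases w) (auto simp: reduced_words_Cons starts_in_def)
qed

lemma letter_mult_letter_mult:
  assumes "\<And>i. i \<in> I \<Longrightarrow> group (G i)" "i \<in> I" "x \<in> carrier (G i)" "y \<in> carrier (G i)"
    and "w \<in> reduced_words I G"
  shows "letter_mult G (i, x) (letter_mult G (i, y) w) = letter_mult G (i, x \<otimes>\<^bsub>G i\<^esub> y) w"
proof (cases w)
  case Nil
  interpret group "G i" by (rule assms)+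
  show ?thesis using assms(3,4) Nil by auto
next
  case (Cons a v)
  interpret group "G i" by (rule assms)+
  obtain j z where a: "a = (j, z)" by (cases a)
  show ?thesis
  proof (cases "i = j")
    case False
    then show ?thesis using assms(3,4) Cons a by auto
  next
    case True
    have z: "z \<in> carrier (G i)" "z \<noteq> \<one>\<^bsub>G i\<^esub>" and v: "\<not> starts_in i v"
      using assms(5) Cons a True by (auto simp: reduced_words_Cons)
    have v': "letter_mult G (i, t) v = (if t = \<one>\<^bsub>G i\<^esub> then v else (i, t) # v)" for t
      using v by (cases v) (auto simp: starts_in_def)
    have w': "letter_mult G (i, t) w = letter_mult G (i, t \<otimes>\<^bsub>G i\<^esub> z) v"
      if "t \<in> carrier (G i)" for t
      using z that Cons a v' by (cases "t = \<one>\<^bsub>G i\<^esub>") (simp_all add: True[symmetric])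
    have "letter_mult G (i, x) (letter_mult G (i, t) v) = letter_mult G (i, x \<otimes>\<^bsub>G i\<^esub> t) v"
      if "t \<in> carrier (G i)" for t
      using assms(3) that v' by auto
    then show ?thesis using w' assms(3,4) z by (simp add: m_assoc)
  qed
qed

lemma foldr_letter_mult_closed:
  assumes "\<And>i. i \<in> I \<Longrightarrow> group (G i)" "u \<in> reduced_words I G" "v \<in> reduced_words I G"
  shows "foldr (letter_mult G) u v \<in> reduced_words I G"
  using assms(2)
proof (induction u)
  case (Cons a u)
  then show ?case
    by (cases a) (auto simp: reduced_words_Cons intro!: letter_mult_closed assms(1))
qed (use assms in simp)

lemma foldr_letter_mult:
  assumes "\<And>i. i \<in> I \<Longrightarrow> group (G i)" "i \<in> I" "x \<in> carrier (G i)"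
    and "u \<in> reduced_words I G" "v \<in> reduced_words I G"
  shows "foldr (letter_mult G) (letter_mult G (i, x) u) v =
         letter_mult G (i, x) (foldr (letter_mult G) u v)"
proof -
  interpret group "G i" by (rule assms)+
  show ?thesis
  proof (cases u)
    case Nil
    then show ?thesis by auto
  next
    case (Cons a u')
    obtain j y where a: "a = (j, y)" by (cases a)
    have jy: "j \<in> I" "y \<in> carrier (G j)" "u' \<in> reduced_words I G"
      using assms(4) Cons a by (auto simp: reduced_words_Cons)
    have cl: "foldr (letter_mult G) u' v \<in> reduced_words I G"
      by (rule foldr_letter_mult_closed) (use assms jy in auto)
    show ?thesis
    proof (cases "i = j")
      case False
      then show ?thesis using Cons a by auto
    next
      case True
      have "letter_mult G (i, x) (letter_mult G (i, y) (foldr (letter_mult G) u' v)) =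
            letter_mult G (i, x \<otimes>\<^bsub>G i\<^esub> y) (foldr (letter_mult G) u' v)"
        using letter_mult_letter_mult[OF assms(1-3) _ cl] jy True by simp
      moreover have "letter_mult G (i, x) u =
          (if x \<otimes>\<^bsub>G i\<^esub> y = \<one>\<^bsub>G i\<^esub> then u' else (i, x \<otimes>\<^bsub>G i\<^esub> y) # u')"
        using Cons a jy assms(4)
        by (cases "x = \<one>\<^bsub>G i\<^esub>") (simp_all add: True[symmetric] reduced_words_Cons)
      ultimately show ?thesis using Cons a True
        by (cases "x \<otimes>\<^bsub>G i\<^esub> y = \<one>\<^bsub>G i\<^esub>") (simp_all del: letter_mult.simps)
    qed
  qed
qed

lemma foldr_letter_mult_assoc:
  assumes G: "\<And>i. i \<in> I \<Longrightarrow> group (G i)" and u: "u \<in> reduced_words I G"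
    and v: "v \<in> reduced_words I G" and w: "w \<in> reduced_words I G"
  shows "foldr (letter_mult G) (foldr (letter_mult G) u v) w =
         foldr (letter_mult G) u (foldr (letter_mult G) v w)"
  using u
proof (induction u)
  case (Cons a u)
  obtain i x where a: "a = (i, x)" by (cases a)
  have ix: "i \<in> I" "x \<in> carrier (G i)" "u \<in> reduced_words I G"
    using Cons.prems a by (auto simp: reduced_words_Cons)
  show ?case
    using foldr_letter_mult[OF G ix(1,2) foldr_letter_mult_closed[OF G ix(3) v] w]
      Cons.IH[OF ix(3)] a by simp
qed simp

lemma foldr_letter_mult_Nil:
  "u \<in> reduced_words I G \<Longrightarrow> foldr (letter_mult G) u [] = u"
proof (induction u)
  case (Cons a u)
  then show ?case by (cases a) (auto simp: letter_mult_eq_Cons reduced_words_Cons)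
qed simp

theorem group_free_product:
  assumes "\<And>i. i \<in> I \<Longrightarrow> group (G i)"
  shows "group (free_product I G)"
proof (rule groupI)
  fix u v w
  assume "u \<in> carrier (free_product I G)" "v \<in> carrier (free_product I G)"
    "w \<in> carrier (free_product I G)"
  then show "u \<otimes>\<^bsub>free_product I G\<^esub> v \<otimes>\<^bsub>free_product I G\<^esub> w =
    u \<otimes>\<^bsub>free_product I G\<^esub> (v \<otimes>\<^bsub>free_product I G\<^esub> w)"
    using foldr_letter_mult_assoc[OF assms] by simp
next
  fix u assume "u \<in> carrier (free_product I G)"
  then have "u \<in> reduced_words I G" by simp
  then have "\<exists>v \<in> reduced_words I G. foldr (letter_mult G) v u = []"
  proof (induction u)
    case (Cons a u)
    obtain i x where a: "a = (i, x)" by (cases a)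
    have ix: "i \<in> I" "x \<in> carrier (G i)" "x \<noteq> \<one>\<^bsub>G i\<^esub>" "u \<in> reduced_words I G" "\<not> starts_in i u"
      using Cons.prems a by (auto simp: reduced_words_Cons)
    then interpret group "G i" using assms by simp
    obtain v where v: "v \<in> reduced_words I G" "foldr (letter_mult G) v u = []"
      using Cons.IH ix by blast
    let ?y = "[(i, inv\<^bsub>G i\<^esub> x)]"
    have y: "?y \<in> reduced_words I G"
      using ix by (auto simp: reduced_words_Cons starts_in_def inv_eq_1_iff)
    have vy: "foldr (letter_mult G) v ?y \<in> reduced_words I G"
      by (rule foldr_letter_mult_closed) (use assms v y in auto)
    have step: "letter_mult G (i, inv\<^bsub>G i\<^esub> x) ((i, x) # u) = u"
      using ix by (auto simp: inv_eq_1_iff)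
    have "(i, x) # u \<in> reduced_words I G" using ix by (simp add: reduced_words_Cons)
    then have "foldr (letter_mult G) (foldr (letter_mult G) v ?y) ((i, x) # u) = []"
      using foldr_letter_mult_assoc[OF assms v(1) y] v(2) step by simp
    then show ?case using vy a by auto
  qed (auto intro: bexI[of _ "[]"])
  then show "\<exists>v \<in> carrier (free_product I G). v \<otimes>\<^bsub>free_product I G\<^esub> u = \<one>\<^bsub>free_product I G\<^esub>"
    by simp
qed (auto intro: foldr_letter_mult_closed assms)

lemma factor_embed_hom:
  assumes "group (G i)" "i \<in> I"
  shows "factor_embed G i \<in> hom (G i) (free_product I G)" "inj (factor_embed G i)"
proof -
  interpret group "G i" by fact
  show "factor_embed G i \<in> hom (G i) (free_product I G)"
    using assms by (auto simp: hom_def factor_embed_def reduced_words_Cons starts_in_def)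
  show "inj (factor_embed G i)"
    by (auto simp: inj_def factor_embed_def split: if_splits)
qed

lemma free_product_normal_form:
  assumes "w \<in> reduced_words I G"
  shows "foldr (\<otimes>\<^bsub>free_product I G\<^esub>) (map (\<lambda>(i, x). factor_embed G i x) w) \<one>\<^bsub>free_product I G\<^esub> = w"
  using assms
proof (induction w)
  case (Cons a w)
  then show ?case
    by (cases a) (auto simp: reduced_words_Cons factor_embed_def
        letter_mult_eq_Cons)
qed simp

theorem free_product_universal:
  assumes G: "\<And>i. i \<in> I \<Longrightarrow> group (G i)" and H: "group H"
    and h: "\<And>i. i \<in> I \<Longrightarrow> h i \<in> hom (G i) H"
  shows "\<exists>f \<in> hom (free_product I G) H. \<forall>i \<in> I. \<forall>x \<in> carrier (G i). f (factor_embed G i x) = h i x"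
proof -
  interpret H: group H by fact
  define f where "f w = foldr (\<lambda>(i, x) y. h i x \<otimes>\<^bsub>H\<^esub> y) w \<one>\<^bsub>H\<^esub>" for w
  have hc: "h i x \<in> carrier H" if "i \<in> I" "x \<in> carrier (G i)" for i x
    using h[OF that(1)] that(2) by (auto simp: hom_def)
  have h1: "h i \<one>\<^bsub>G i\<^esub> = \<one>\<^bsub>H\<^esub>" if "i \<in> I" for i
    using hom_one[OF h[OF that] G[OF that] H] .
  have hm: "h i (x \<otimes>\<^bsub>G i\<^esub> y) = h i x \<otimes>\<^bsub>H\<^esub> h i y"
    if "i \<in> I" "x \<in> carrier (G i)" "y \<in> carrier (G i)" for i x y
    using h[OF that(1)] that(2,3) by (auto simp: hom_def)
  have fc: "f w \<in> carrier H" if "w \<in> reduced_words I G" for w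
    using that
  proof (induction w)
    case (Cons a w)
    then show ?case by (cases a) (auto simp: f_def reduced_words_Cons hc)
  qed (simp add: f_def)
  have fl: "f (letter_mult G (i, x) w) = h i x \<otimes>\<^bsub>H\<^esub> f w"
    if "i \<in> I" "x \<in> carrier (G i)" "w \<in> reduced_words I G" for i x w
  proof (cases w)
    case Nil
    then show ?thesis using that by (auto simp: f_def h1 hc)
  next
    case (Cons a v)
    obtain j y where a: "a = (j, y)" by (cases a)
    have jy: "j \<in> I" "y \<in> carrier (G j)" "v \<in> reduced_words I G"
      using that(3) Cons a by (auto simp: reduced_words_Cons)
    have "f w = h j y \<otimes>\<^bsub>H\<^esub> f v" by (simp add: f_def Cons a)
    moreover have "f ((k, t) # u) = h k t \<otimes>\<^bsub>H\<^esub> f u" for k t u by (simp add: f_def)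
    moreover have "h i x \<otimes>\<^bsub>H\<^esub> (h i y \<otimes>\<^bsub>H\<^esub> f v) = h i (x \<otimes>\<^bsub>G i\<^esub> y) \<otimes>\<^bsub>H\<^esub> f v" if "i = j"
      using jy fc[OF jy(3)] \<open>i \<in> I\<close> \<open>x \<in> carrier (G i)\<close> that by (simp add: hm hc H.m_assoc)
    ultimately show ?thesis
      using that Cons a jy fc[OF jy(3)] fc[OF that(3)] by (auto simp: h1 hc)
  qed
  have "f (foldr (letter_mult G) u v) = f u \<otimes>\<^bsub>H\<^esub> f v"
    if "u \<in> reduced_words I G" "v \<in> reduced_words I G" for u v
    using that(1)
  proof (induction u)
    case Nil
    then show ?case using fc[OF that(2)] by (simp add: f_def)
  next
    case (Cons a u)
    obtain i x where a: "a = (i, x)" by (cases a)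
    have ix: "i \<in> I" "x \<in> carrier (G i)" "u \<in> reduced_words I G"
      using Cons.prems a by (auto simp: reduced_words_Cons)
    have "f (a # u) = h i x \<otimes>\<^bsub>H\<^esub> f u" by (simp add: f_def a)
    then show ?case
      using ix Cons.IH a fl[OF ix(1,2) foldr_letter_mult_closed[OF G ix(3) that(2)]]
        fc[OF ix(3)] fc[OF that(2)]
      by (simp add: hc H.m_assoc)
  qed
  then have "f \<in> hom (free_product I G) H" using fc by (auto simp: hom_def)
  moreover have "f (factor_embed G i x) = h i x" if "i \<in> I" "x \<in> carrier (G i)" for i x
    using that by (auto simp: f_def factor_embed_def h1 hc)
  ultimately show ?thesis by blast
qed

section \<open>Word length, generated semigroups and random walks\<close>

definition word_length :: "('g, 'm) monoid_scheme \<Rightarrow> 'g set \<Rightarrow> 'g \<Rightarrow> nat" where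
  "word_length G S g =
     (LEAST n. \<exists>ss. length ss = n \<and> set ss \<subseteq> S \<union> m_inv G ` S \<and> g = foldr (\<otimes>\<^bsub>G\<^esub>) ss \<one>\<^bsub>G\<^esub>)"

inductive_set semigroup_generated :: "('g, 'm) monoid_scheme \<Rightarrow> 'g set \<Rightarrow> 'g set"
  for G and A where
  incl: "g \<in> A \<Longrightarrow> g \<in> semigroup_generated G A"
| mult: "g \<in> semigroup_generated G A \<Longrightarrow> h \<in> semigroup_generated G A \<Longrightarrow>
         g \<otimes>\<^bsub>G\<^esub> h \<in> semigroup_generated G A"

definition measure_support :: "'g measure \<Rightarrow> 'g set" where
  "measure_support \<mu> = {g \<in> space \<mu>. measure \<mu> {g} > 0}"

definition right_random_walk ::
    "'w measure \<Rightarrow> ('g, 'm) monoid_scheme \<Rightarrow> 'g measure \<Rightarrow> (nat \<Rightarrow> 'w \<Rightarrow> 'g) \<Rightarrow> bool" where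
  "right_random_walk M G \<mu> Y \<longleftrightarrow>
     (\<exists>X. prob_space.indep_vars M (\<lambda>_. \<mu>) X {1..} \<and>
          (\<forall>n\<ge>1. distr M \<mu> (X n) = \<mu>) \<and>
          (\<forall>n. \<forall>\<omega>\<in>space M. Y n \<omega> = foldr (\<otimes>\<^bsub>G\<^esub>) (map (\<lambda>k. X k \<omega>) [1..<Suc n]) \<one>\<^bsub>G\<^esub>))"

section \<open>The weak large deviation principle\<close>

definition borel_on :: "'x topology \<Rightarrow> 'x measure" where
  "borel_on T = sigma (topspace T) {U. openin T U}"

definition ext_log :: "real \<Rightarrow> ereal" where
  "ext_log p = (if p = 0 then -\<infinity> else ereal (ln p))"

definition lower_semicontinuous_map :: "'x topology \<Rightarrow> ('x \<Rightarrow> ereal) \<Rightarrow> bool" where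
  "lower_semicontinuous_map T f \<longleftrightarrow> (\<forall>a. openin T {x \<in> topspace T. a < f x})"

text \<open>
  A rate function is only constrained on the underlying set of the topology. For empty \<open>V\<close> the
  infimum is \<open>\<infinity>\<close>, and the value of the sequences at \<open>n = 0\<close> is irrelevant for the limits.
\<close>

definition weak_LDP ::
    "'w measure \<Rightarrow> 'x topology \<Rightarrow> (nat \<Rightarrow> 'w \<Rightarrow> 'x) \<Rightarrow> ('x \<Rightarrow> ereal) \<Rightarrow> bool" where
  "weak_LDP M T Z I \<longleftrightarrow>
     (\<forall>n\<ge>1. Z n \<in> M \<rightarrow>\<^sub>M borel_on T) \<and>
     (\<forall>x\<in>topspace T. 0 \<le> I x) \<and> lower_semicontinuous_map T I \<and>
     (\<forall>V. openin T V \<longrightarrow>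
        liminf (\<lambda>n. ereal (1 / real n) * ext_log (measure (distr M (borel_on T) (Z n)) V))
          \<ge> - (INF x\<in>V. I x)) \<and>
     (\<forall>K. compactin T K \<longrightarrow>
        limsup (\<lambda>n. ereal (1 / real n) * ext_log (measure (distr M (borel_on T) (Z n)) K))
          \<le> - (INF x\<in>K. I x))"

text \<open>The library's \<^const>\<open>convex_on\<close> is restricted to real-valued functions.\<close>

definition ereal_convex_on :: "'v::real_vector set \<Rightarrow> ('v \<Rightarrow> ereal) \<Rightarrow> bool" where
  "ereal_convex_on A f \<longleftrightarrow> convex A \<and>
     (\<forall>t\<in>{0..1}. \<forall>x\<in>A. \<forall>y\<in>A.
        f ((1 - t) *\<^sub>R x + t *\<^sub>R y) \<le> ereal (1 - t) * f x + ereal t * f y)"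

end

theory Submission
  imports Defs "HOL-Real_Asymp.Real_Asymp"
begin

text \<open>
  Write \<open>P n\<close> for the law of \<open>Y n\<close>, the \<open>n\<close>-fold convolution power of \<open>\<mu>\<close>. Everything rests on one
  estimate: there are constants \<open>K\<close>, \<open>C\<close>, \<open>\<gamma>\<close> such that
  \<open>P m (|\<ell> - a| \<le> d) \<cdot> P n (|\<ell> - b| \<le> e) \<le> exp \<gamma> \<cdot> P (m + n + K) (|\<ell> - (a + b)| \<le> d + e + C)\<close>.

  The word length of a reduced word is the sum of the word lengths of its letters in the factors
  (\<open>word_length_free_product\<close>), so \<open>\<ell>\<close> is additive on products without cancellation. Cancellation
  between \<open>u\<close> and \<open>v\<close> is prevented by inserting a word \<open>f\<close> that does not start in the factor in
  which \<open>u\<close> ends and does not end in the factor in which \<open>v\<close> starts. The hypothesis on the semigroup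
  \<open>\<Gamma>\<close> provides such an \<open>f \<in> \<Gamma>\<close> for each of the finitely many pairs of factors (\<open>connecting_word\<close>), and
  membership in \<open>\<Gamma>\<close> means that the walk produces \<open>f\<close> with positive probability after some number of
  steps. That number depends on the pair of factors; it is made equal to \<open>K\<close> by letting the walk
  repeat a fixed step \<open>s\<close> of the support after \<open>v\<close>, which moves \<open>\<ell>\<close> by a bounded amount
  (\<open>padding\<close>). Summing over the pairs of factors gives the estimate
  (\<open>approx_superadditive_word_length\<close>).

  The rest only uses the laws \<open>Q n\<close> of \<open>\<ell> (Y n)\<close>. Call an exponent \<open>h\<close> attainable at \<open>x\<close> if for every
  \<open>\<epsilon> > 0\<close> the event \<open>|\<ell> - n x| \<le> n \<epsilon>\<close> has probability at least \<open>exp (- h n)\<close> for infinitely many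
  \<open>n\<close>, and let the rate at \<open>x\<close> be the infimum of the attainable exponents. Repeating a good block
  of length \<open>n\<close> shows, in the manner of Fekete's lemma, that a slightly larger exponent is reached for
  all large \<open>n\<close> (\<open>attainable_eventually\<close>); this is the equality of the lower and upper local rates,
  which yields the two bounds of the weak large deviation principle. Joining a block of speed \<open>x\<close> to a
  block of speed \<open>y\<close> gives convexity (\<open>attainable_convex\<close>).
\<close>

section \<open>Word length\<close>

text \<open>
  Word length is a least element, hence meaningless on elements that are not products of generators;
  the relation below keeps track of which lengths are realised.
\<close>

definition word_of_length :: "('g, 'm) monoid_scheme \<Rightarrow> 'g set \<Rightarrow> nat \<Rightarrow> 'g \<Rightarrow> bool" where
  "word_of_length H S n g \<longleftrightarrow>
     (\<exists>ss. length ss = n \<and> set ss \<subseteq> S \<union> m_inv H ` S \<and> g = foldr (\<otimes>\<^bsub>H\<^esub>) ss \<one>\<^bsub>H\<^esub>)"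

lemma word_length_le: "word_of_length H S n g \<Longrightarrow> word_length H S g \<le> n"
  unfolding word_length_def word_of_length_def by (rule Least_le)

lemma word_of_length_word_length: "word_of_length H S n g \<Longrightarrow> word_of_length H S (word_length H S g) g"
  unfolding word_length_def word_of_length_def by (rule LeastI)

lemma word_of_length_one: "word_of_length H S 0 \<one>\<^bsub>H\<^esub>"
  by (simp add: word_of_length_def)

lemma word_length_one: "word_length H S \<one>\<^bsub>H\<^esub> = 0"
  using word_length_le[OF word_of_length_one] by simp

context group
begin

lemma word_of_length_letter:
  "S \<subseteq> carrier G \<Longrightarrow> s \<in> S \<union> m_inv G ` S \<Longrightarrow> word_of_length G S 1 s"
  unfolding word_of_length_def by (rule exI[of _ "[s]"]) auto

lemma foldr_mult_closed: "set ss \<subseteq> carrier G \<Longrightarrow> foldr (\<otimes>) ss \<one> \<in> carrier G"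
  by (induction ss) auto

lemma foldr_mult_append:
  "set ss \<subseteq> carrier G \<Longrightarrow> set ts \<subseteq> carrier G \<Longrightarrow>
     foldr (\<otimes>) (ss @ ts) \<one> = foldr (\<otimes>) ss \<one> \<otimes> foldr (\<otimes>) ts \<one>"
  by (induction ss) (auto simp: m_assoc foldr_mult_closed simp del: foldr_append)

lemma word_of_length_mult:
  assumes "S \<subseteq> carrier G" "word_of_length G S m g" "word_of_length G S n h"
  shows "word_of_length G S (m + n) (g \<otimes> h)"
proof -
  obtain ss ts where st: "length ss = m" "set ss \<subseteq> S \<union> m_inv G ` S" "g = foldr (\<otimes>) ss \<one>"
      "length ts = n" "set ts \<subseteq> S \<union> m_inv G ` S" "h = foldr (\<otimes>) ts \<one>"
    using assms unfolding word_of_length_def by blast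
  have "S \<union> m_inv G ` S \<subseteq> carrier G" using assms(1) by auto
  then have "foldr (\<otimes>) (ss @ ts) \<one> = g \<otimes> h"
    using st by (subst foldr_mult_append) auto
  then show ?thesis
    unfolding word_of_length_def using st by (intro exI[of _ "ss @ ts"]) auto
qed

lemma generate_word_of_length:
  assumes "S \<subseteq> carrier G" "g \<in> generate G S"
  shows "\<exists>n. word_of_length G S n g"
  using assms(2)
proof induction
  case one
  show ?case using word_of_length_one by blast
next
  case (incl h)
  then show ?case using word_of_length_letter[OF assms(1)] by blast
next
  case (inv h)
  then show ?case using word_of_length_letter[OF assms(1)] by blast
next
  case (eng g h)
  then show ?case using word_of_length_mult[OF assms(1)] by blast
qed

lemma word_length_mult_le:
  assumes "S \<subseteq> carrier G" "g \<in> generate G S" "h \<in> generate G S"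
  shows "word_length G S (g \<otimes> h) \<le> word_length G S g + word_length G S h"
  using generate_word_of_length[OF assms(1,2)] generate_word_of_length[OF assms(1,3)]
    word_of_length_mult[OF assms(1)] word_of_length_word_length word_length_le
  by meson

lemma countable_generate:
  assumes "S \<subseteq> carrier G" "countable S"
  shows "countable (generate G S)"
proof (rule countable_subset)
  show "generate G S \<subseteq> (\<lambda>ss. foldr (\<otimes>) ss \<one>) ` lists (S \<union> m_inv G ` S)"
    using generate_word_of_length[OF assms(1)] unfolding word_of_length_def by (fastforce simp: in_lists_conv_set)
  show "countable ((\<lambda>ss. foldr (\<otimes>) ss \<one>) ` lists (S \<union> m_inv G ` S))"
    using assms(2) by (intro countable_image countable_lists countable_Un) auto
qed

end

section \<open>Word length in a free product\<close>

locale fg_free_product =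
  fixes I :: "'i set" and G :: "'i \<Rightarrow> ('a, 'b) monoid_scheme" and S :: "'i \<Rightarrow> 'a set"
  assumes finite_I: "finite I"
    and group_factor: "\<And>i. i \<in> I \<Longrightarrow> group (G i)"
    and finite_S: "\<And>i. i \<in> I \<Longrightarrow> finite (S i)"
    and S_carrier: "\<And>i. i \<in> I \<Longrightarrow> S i \<subseteq> carrier (G i)"
    and generate_S: "\<And>i. i \<in> I \<Longrightarrow> generate (G i) (S i) = carrier (G i)"
begin

abbreviation "F \<equiv> free_product I G"
abbreviation "SF \<equiv> (\<Union>i\<in>I. factor_embed G i ` S i)"

sublocale F: group F
  by (rule group_free_product) (rule group_factor)

definition letter_length_sum :: "('i \<times> 'a) list \<Rightarrow> nat" where
  "letter_length_sum w = (\<Sum>(i, x)\<leftarrow>w. word_length (G i) (S i) x)"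

lemma letter_length_sum_simps [simp]:
  "letter_length_sum [] = 0"
  "letter_length_sum ((i, x) # w) = word_length (G i) (S i) x + letter_length_sum w"
  "letter_length_sum (u @ v) = letter_length_sum u + letter_length_sum v"
  by (simp_all add: letter_length_sum_def)

lemma factor_embed_reduced:
  "i \<in> I \<Longrightarrow> x \<in> carrier (G i) \<Longrightarrow> factor_embed G i x \<in> reduced_words I G"
  by (simp add: factor_embed_def reduced_words_Cons starts_in_def)

lemma factor_embed_mult: "foldr (letter_mult G) (factor_embed G i x) w = letter_mult G (i, x) w"
  by (simp add: factor_embed_def)

lemma SF_carrier: "SF \<subseteq> carrier F"
  using S_carrier factor_embed_reduced by fastforce

lemma inv_factor_embed:
  assumes "i \<in> I" "x \<in> carrier (G i)"
  shows "m_inv F (factor_embed G i x) = factor_embed G i (m_inv (G i) x)"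
proof -
  interpret group_hom "G i" F "factor_embed G i"
    using factor_embed_hom(1)[where G = G and i = i and I = I, OF group_factor[OF assms(1)] assms(1)] group_factor[OF assms(1)]
    by (intro group_hom.intro F.group_axioms group_hom_axioms.intro) auto
  show ?thesis using hom_inv assms by simp
qed

lemma SF_inv_cases:
  assumes "s \<in> SF \<union> m_inv F ` SF"
  obtains i x where "i \<in> I" "x \<in> S i \<union> m_inv (G i) ` S i" "x \<in> carrier (G i)" "s = factor_embed G i x"
proof -
  have "\<exists>i\<in>I. \<exists>x\<in>S i. s = factor_embed G i x \<or> s = m_inv F (factor_embed G i x)"
    using assms by blast
  then obtain i x where ix: "i \<in> I" "x \<in> S i" "s = factor_embed G i x \<or> s = m_inv F (factor_embed G i x)"
    by blast
  interpret group "G i" using ix group_factor by simp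
  have x: "x \<in> carrier (G i)" using ix S_carrier by blast
  from ix(3) show thesis
  proof
    assume "s = factor_embed G i x"
    then show thesis using that[of i x] ix x by blast
  next
    assume "s = m_inv F (factor_embed G i x)"
    then show thesis using that[of i "m_inv (G i) x"] ix x inv_factor_embed[OF ix(1) x] by auto
  qed
qed

lemma letter_length_sum_letter_mult:
  assumes "i \<in> I" "x \<in> carrier (G i)" "w \<in> reduced_words I G"
  shows "letter_length_sum (letter_mult G (i, x) w) \<le> word_length (G i) (S i) x + letter_length_sum w"
proof (cases w)
  case (Cons a v)
  obtain j y where a: "a = (j, y)" by (cases a)
  interpret group "G i" using assms group_factor by simp
  have "word_length (G i) (S i) (x \<otimes>\<^bsub>G i\<^esub> y) \<le> word_length (G i) (S i) x + word_length (G i) (S i) y"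
    if "i = j"
    using assms that Cons a S_carrier generate_S
    by (intro word_length_mult_le) (auto simp: reduced_words_Cons)
  then show ?thesis using Cons a by auto
qed (auto simp: word_length_one)

lemma letter_length_sum_le_length:
  assumes "set ss \<subseteq> SF \<union> m_inv F ` SF"
  shows "letter_length_sum (foldr (\<otimes>\<^bsub>F\<^esub>) ss \<one>\<^bsub>F\<^esub>) \<le> length ss"
  using assms
proof (induction ss)
  case (Cons s ss)
  obtain i x where ix: "i \<in> I" "x \<in> S i \<union> m_inv (G i) ` S i" "x \<in> carrier (G i)" "s = factor_embed G i x"
    using Cons.prems SF_inv_cases[of s] by auto
  define w where "w = foldr (\<otimes>\<^bsub>F\<^esub>) ss \<one>\<^bsub>F\<^esub>"
  have "SF \<union> m_inv F ` SF \<subseteq> carrier F"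
    using SF_carrier F.inv_closed by (auto simp del: free_product_simps)
  then have "set ss \<subseteq> carrier F" using Cons.prems by (meson order_trans set_subset_Cons)
  then have w: "w \<in> reduced_words I G" using F.foldr_mult_closed w_def by simp
  have "word_length (G i) (S i) x \<le> 1"
    using group.word_of_length_letter[OF group_factor S_carrier] ix by (intro word_length_le) blast
  moreover have "s \<otimes>\<^bsub>F\<^esub> w = letter_mult G (i, x) w" using ix by (simp add: factor_embed_mult)
  ultimately have "letter_length_sum (s \<otimes>\<^bsub>F\<^esub> w) \<le> 1 + letter_length_sum w"
    using letter_length_sum_letter_mult[OF ix(1,3) w] by simp
  moreover have "letter_length_sum w \<le> length ss"
    unfolding w_def using Cons.prems by (intro Cons.IH) (meson order_trans set_subset_Cons)
  moreover have "foldr (\<otimes>\<^bsub>F\<^esub>) (s # ss) \<one>\<^bsub>F\<^esub> = s \<otimes>\<^bsub>F\<^esub> w" unfolding w_def by (simp only: foldr.simps o_apply)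
  ultimately show ?case by (simp only: length_Cons)
qed simp

lemma word_of_length_factor_embed:
  assumes "i \<in> I" "word_of_length (G i) (S i) n x"
  shows "word_of_length F SF n (factor_embed G i x)"
proof -
  interpret group "G i" using assms group_factor by simp
  obtain ss where ss: "length ss = n" "set ss \<subseteq> S i \<union> m_inv (G i) ` S i" "x = foldr (\<otimes>\<^bsub>G i\<^esub>) ss \<one>\<^bsub>G i\<^esub>"
    using assms(2) unfolding word_of_length_def by blast
  have "set ss \<subseteq> carrier (G i)" using ss(2) S_carrier[OF assms(1)] by auto
  then have "factor_embed G i (foldr (\<otimes>\<^bsub>G i\<^esub>) ss \<one>\<^bsub>G i\<^esub>) = foldr (\<otimes>\<^bsub>F\<^esub>) (map (factor_embed G i) ss) \<one>\<^bsub>F\<^esub>"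
  proof (induction ss)
    case Nil
    then show ?case by (simp add: factor_embed_def)
  next
    case (Cons s ss)
    then have "factor_embed G i (s \<otimes>\<^bsub>G i\<^esub> foldr (\<otimes>\<^bsub>G i\<^esub>) ss \<one>\<^bsub>G i\<^esub>) =
        factor_embed G i s \<otimes>\<^bsub>F\<^esub> factor_embed G i (foldr (\<otimes>\<^bsub>G i\<^esub>) ss \<one>\<^bsub>G i\<^esub>)"
      using factor_embed_hom(1)[where G = G and i = i and I = I, OF group_factor[OF assms(1)] assms(1)] foldr_mult_closed unfolding hom_def by auto
    then show ?case using Cons by simp
  qed
  moreover have "set (map (factor_embed G i) ss) \<subseteq> SF \<union> m_inv F ` SF"
  proof -
    have "factor_embed G i s \<in> SF \<union> m_inv F ` SF" if "s \<in> set ss" for s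
    proof -
      have "s \<in> S i \<or> (\<exists>t\<in>S i. s = m_inv (G i) t)" using ss(2) that by blast
      then consider "s \<in> S i" | t where "t \<in> S i" "s = m_inv (G i) t" by blast
      then show ?thesis
      proof cases
        case 2
        then have "factor_embed G i s = m_inv F (factor_embed G i t)"
          using inv_factor_embed[OF assms(1)] S_carrier[OF assms(1)] by auto
        then show ?thesis using 2 assms(1) by blast
      qed (use assms(1) in blast)
    qed
    then show ?thesis unfolding set_map by (rule image_subsetI)
  qed
  ultimately show ?thesis
    unfolding word_of_length_def using ss by (intro exI[of _ "map (factor_embed G i) ss"]) simp
qed

lemma word_of_length_letter_length_sum:
  "w \<in> reduced_words I G \<Longrightarrow> word_of_length F SF (letter_length_sum w) w"
proof (induction w)
  case Nil
  show ?case using word_of_length_one[of F SF] by simp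
next
  case (Cons a w)
  obtain i x where a: "a = (i, x)" by (cases a)
  have ix: "i \<in> I" "x \<in> carrier (G i)" "w \<in> reduced_words I G"
    using Cons.prems a by (auto simp: reduced_words_Cons)
  interpret group "G i" using ix group_factor by simp
  have "word_of_length (G i) (S i) (word_length (G i) (S i) x) x"
    using generate_word_of_length[OF S_carrier[OF ix(1)], of x] generate_S[OF ix(1)] ix(2)
    by (auto intro: word_of_length_word_length)
  then have "word_of_length F SF (word_length (G i) (S i) x + letter_length_sum w) (factor_embed G i x \<otimes>\<^bsub>F\<^esub> w)"
    using ix Cons.IH by (intro F.word_of_length_mult SF_carrier word_of_length_factor_embed) auto
  moreover have "factor_embed G i x \<otimes>\<^bsub>F\<^esub> w = a # w"
    using Cons.prems by (simp add: a factor_embed_mult letter_mult_eq_Cons)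
  ultimately show ?case by (simp add: a)
qed

text \<open>
  Writing out the letters of a reduced word gives an expression of length \<open>letter_length_sum w\<close>.
  Conversely, multiplying by one generator changes a single letter, and increases the sum by at most
  \<open>1\<close>, because the word length of a factor is subadditive; so no expression is shorter.
\<close>

theorem word_length_free_product:
  assumes "w \<in> reduced_words I G"
  shows "word_length F SF w = letter_length_sum w"
proof (rule antisym)
  show "word_length F SF w \<le> letter_length_sum w"
    using word_of_length_letter_length_sum[OF assms] by (rule word_length_le)
  obtain ss where ss: "length ss = word_length F SF w" "set ss \<subseteq> SF \<union> m_inv F ` SF" "w = foldr (\<otimes>\<^bsub>F\<^esub>) ss \<one>\<^bsub>F\<^esub>"
    using word_of_length_word_length[OF word_of_length_letter_length_sum[OF assms]]
    unfolding word_of_length_def by blast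
  show "letter_length_sum w \<le> word_length F SF w"
    using letter_length_sum_le_length[OF ss(2)] unfolding ss(1) ss(3) [symmetric] .
qed

lemma reduced_words_append:
  assumes "u \<in> reduced_words I G" "v \<in> reduced_words I G"
    and "\<And>i. ends_in i u \<Longrightarrow> \<not> starts_in i v"
  shows "u @ v \<in> reduced_words I G" "u \<otimes>\<^bsub>F\<^esub> v = u @ v"
proof -
  show uv: "u @ v \<in> reduced_words I G"
    using assms unfolding reduced_words_def
    by (auto simp: successively_append_iff ends_in_def starts_in_def split: prod.splits)
  then have "foldr (letter_mult G) u v = u @ v"
  proof (induction u)
    case (Cons a u)
    then show ?case by (cases a) (auto simp: reduced_words_Cons letter_mult_eq_Cons)
  qed simp
  then show "u \<otimes>\<^bsub>F\<^esub> v = u @ v" by simp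
qed

lemma word_length_mult_no_cancellation:
  assumes "u \<in> reduced_words I G" "v \<in> reduced_words I G" "\<And>i. ends_in i u \<Longrightarrow> \<not> starts_in i v"
  shows "word_length F SF (u \<otimes>\<^bsub>F\<^esub> v) = word_length F SF u + word_length F SF v"
  using reduced_words_append[OF assms] assms by (simp add: word_length_free_product)

lemma word_length_free_product_mult_le:
  assumes "u \<in> carrier F" "v \<in> carrier F"
  shows "word_length F SF (u \<otimes>\<^bsub>F\<^esub> v) \<le> word_length F SF u + word_length F SF v"
proof -
  have "word_of_length F SF (word_length F SF g) g" if "g \<in> carrier F" for g
    using that word_of_length_letter_length_sum word_length_free_product by simp
  then show ?thesis
    using assms by (intro word_length_le F.word_of_length_mult SF_carrier)
qed

lemma word_length_right_mult:
  assumes "u \<in> carrier F" "s \<in> carrier F"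
  shows "\<bar>real (word_length F SF (u \<otimes>\<^bsub>F\<^esub> s)) - real (word_length F SF u)\<bar>
           \<le> real (word_length F SF s + word_length F SF (m_inv F s))"
proof -
  have "u = (u \<otimes>\<^bsub>F\<^esub> s) \<otimes>\<^bsub>F\<^esub> m_inv F s" 
    using F.inv_solve_right' F.m_closed assms by metis
  then have "word_length F SF u \<le> word_length F SF (u \<otimes>\<^bsub>F\<^esub> s) + word_length F SF (m_inv F s)"
    using word_length_free_product_mult_le[of "u \<otimes>\<^bsub>F\<^esub> s" "m_inv F s"] assms F.m_closed F.inv_closed by metis
  moreover have "word_length F SF (u \<otimes>\<^bsub>F\<^esub> s) \<le> word_length F SF u + word_length F SF s"
    using assms by (rule word_length_free_product_mult_le)
  ultimately show ?thesis by linarith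
qed

lemma countable_carrier: "countable (carrier F)"
proof (rule countable_subset)
  show "carrier F \<subseteq> lists (SIGMA i:I. carrier (G i))"
    by (force simp: reduced_words_def in_lists_conv_set)
  have "countable (carrier (G i))" if "i \<in> I" for i
    using group.countable_generate[OF group_factor[OF that] S_carrier[OF that]]
      finite_S[OF that] generate_S[OF that] by (simp add: countable_finite)
  then show "countable (lists (SIGMA i:I. carrier (G i)))"
    using finite_I by (intro countable_lists countable_SIGMA) (auto simp: countable_finite)
qed

lemma semigroup_generated_carrier:
  "A \<subseteq> carrier F \<Longrightarrow> g \<in> semigroup_generated F A \<Longrightarrow> g \<in> carrier F"
  by (erule semigroup_generated.induct) (auto intro: F.m_closed simp del: free_product_simps)

text \<open>
  Let \<open>g\<close> and \<open>h\<close> be the elements that avoid the factors \<open>i\<close> and \<open>j\<close>. If neither of them has both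
  required properties, then \<open>g\<close> ends in \<open>j\<close> and \<open>h\<close> starts in \<open>i\<close>. As \<open>h\<close> does not start in \<open>j\<close>, the
  product \<open>g h\<close> is reduced, and it inherits its start from \<open>g\<close> and its end from \<open>h\<close>.
\<close>

lemma connecting_word:
  assumes "A \<subseteq> carrier F"
    and avoid: "\<And>i. i \<in> I \<Longrightarrow> \<exists>g \<in> semigroup_generated F A. g \<noteq> \<one>\<^bsub>F\<^esub> \<and> \<not> starts_in i g \<and> \<not> ends_in i g"
    and "i \<in> I" "j \<in> I"
  shows "\<exists>f \<in> semigroup_generated F A. f \<noteq> [] \<and> \<not> starts_in i f \<and> \<not> ends_in j f"
proof -
  obtain g where g: "g \<in> semigroup_generated F A" "g \<noteq> []" "\<not> starts_in i g" "\<not> ends_in i g"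
    using avoid[OF \<open>i \<in> I\<close>] by auto
  obtain h where h: "h \<in> semigroup_generated F A" "h \<noteq> []" "\<not> starts_in j h" "\<not> ends_in j h"
    using avoid[OF \<open>j \<in> I\<close>] by auto
  consider "\<not> ends_in j g" | "\<not> starts_in i h" | "ends_in j g" "starts_in i h" by blast
  then show ?thesis
  proof cases
    case 1
    then show ?thesis using g by blast
  next
    case 2
    then show ?thesis using h by blast
  next
    case 3
    have "\<not> starts_in k h" if "ends_in k g" for k
      using that 3 h by (auto simp: ends_in_def starts_in_def)
    then have "g \<otimes>\<^bsub>F\<^esub> h = g @ h"
      using g h semigroup_generated_carrier[OF assms(1)] by (intro reduced_words_append) auto
    moreover have "\<not> starts_in i (g @ h)" "\<not> ends_in j (g @ h)"
      using g h by (auto simp: starts_in_def ends_in_def)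
    ultimately show ?thesis
      using semigroup_generated.mult[OF g(1) h(1)] g(2) by (intro bexI[of _ "g @ h"]) auto
  qed
qed

lemma word_length_connected:
  assumes "u \<in> carrier F" "f \<in> carrier F" "v \<in> carrier F" "f \<noteq> []"
    and "u = [] \<or> ends_in i u" "v = [] \<or> starts_in j v" "\<not> starts_in i f" "\<not> ends_in j f"
  shows "word_length F SF (u \<otimes>\<^bsub>F\<^esub> f \<otimes>\<^bsub>F\<^esub> v) = word_length F SF u + word_length F SF f + word_length F SF v"
proof -
  have u: "\<not> starts_in k f" if "ends_in k u" for k
    using that assms by (auto simp: ends_in_def starts_in_def)
  have uf: "u \<otimes>\<^bsub>F\<^esub> f = u @ f" "u @ f \<in> reduced_words I G"
    using reduced_words_append[of u f] u assms by auto
  have v: "\<not> starts_in k v" if "ends_in k (u @ f)" for k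
    using that assms by (auto simp: ends_in_def starts_in_def)
  show ?thesis
    using word_length_mult_no_cancellation[of "u @ f" v] word_length_mult_no_cancellation[of u f] u v uf assms
    by simp
qed

end

section \<open>Convolution powers\<close>

primrec conv_power :: "('g, 'm) monoid_scheme \<Rightarrow> 'g pmf \<Rightarrow> nat \<Rightarrow> 'g pmf" where
  "conv_power H p 0 = return_pmf \<one>\<^bsub>H\<^esub>"
| "conv_power H p (Suc n) = bind_pmf (conv_power H p n) (\<lambda>u. map_pmf (\<lambda>x. u \<otimes>\<^bsub>H\<^esub> x) p)"

context group
begin

lemma set_conv_power: "set_pmf p \<subseteq> carrier G \<Longrightarrow> set_pmf (conv_power G p n) \<subseteq> carrier G"
  by (induction n) auto

text \<open>
  The increments over disjoint time intervals are independent, and the increment over \<open>n\<close> steps has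
  the law of \<open>Y n\<close>; associativity is only available on the carrier, which contains the support.
\<close>

lemma conv_power_add:
  assumes "set_pmf p \<subseteq> carrier G"
  shows "conv_power G p (m + n) =
     bind_pmf (conv_power G p m) (\<lambda>u. map_pmf (\<lambda>v. u \<otimes> v) (conv_power G p n))"
proof (induction n)
  case 0
  have "bind_pmf (conv_power G p m) (\<lambda>u. map_pmf (\<lambda>v. u \<otimes> v) (return_pmf \<one>)) =
      bind_pmf (conv_power G p m) return_pmf"
    using set_conv_power[OF assms, of m] by (intro bind_pmf_cong) auto
  then show ?case by (simp add: bind_return_pmf')
next
  case (Suc n)
  have "conv_power G p (m + Suc n) =
      bind_pmf (conv_power G p m) (\<lambda>u. bind_pmf (conv_power G p n) (\<lambda>v. map_pmf (\<lambda>x. (u \<otimes> v) \<otimes> x) p))"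
    by (simp add: Suc bind_assoc_pmf bind_map_pmf)
  also have "\<dots> = bind_pmf (conv_power G p m) (\<lambda>u. bind_pmf (conv_power G p n) (\<lambda>v. map_pmf (\<lambda>x. u \<otimes> (v \<otimes> x)) p))"
    using set_conv_power[OF assms, of m] set_conv_power[OF assms, of n] assms
    by (intro bind_pmf_cong map_pmf_cong refl m_assoc) blast+
  also have "\<dots> = bind_pmf (conv_power G p m) (\<lambda>u. map_pmf (\<lambda>v. u \<otimes> v) (conv_power G p (Suc n)))"
    by (simp add: map_bind_pmf pmf.map_comp o_def)
  finally show ?case .
qed

lemma conv_power_1: "set_pmf p \<subseteq> carrier G \<Longrightarrow> conv_power G p 1 = p"
proof -
  assume "set_pmf p \<subseteq> carrier G"
  then have "map_pmf (\<lambda>x. \<one> \<otimes> x) p = map_pmf (\<lambda>x. x) p"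
    by (intro map_pmf_cong) auto
  then show ?thesis by (simp add: bind_return_pmf)
qed

lemma conv_power_prob_mult:
  assumes "set_pmf p \<subseteq> carrier G"
    and "\<And>u v. u \<in> A \<Longrightarrow> v \<in> B \<Longrightarrow> u \<in> carrier G \<Longrightarrow> v \<in> carrier G \<Longrightarrow> u \<otimes> v \<in> D"
  shows "measure_pmf.prob (conv_power G p m) A * measure_pmf.prob (conv_power G p n) B
           \<le> measure_pmf.prob (conv_power G p (m + n)) D"
proof -
  let ?A = "A \<inter> set_pmf (conv_power G p m)" and ?B = "B \<inter> set_pmf (conv_power G p n)"
  have "measure_pmf.prob (conv_power G p m) A * measure_pmf.prob (conv_power G p n) B
      = measure_pmf.prob (pair_pmf (conv_power G p m) (conv_power G p n)) (?A \<times> ?B)"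
    by (subst measure_pmf_prob_product) (simp_all add: measure_Int_set_pmf)
  also have "\<dots> \<le> measure_pmf.prob (pair_pmf (conv_power G p m) (conv_power G p n)) ((\<lambda>(u, v). u \<otimes> v) -` D)"
    using set_conv_power[OF assms(1), of m] set_conv_power[OF assms(1), of n] 
    by (intro measure_pmf.finite_measure_mono) (auto intro!: assms(2))
  also have "\<dots> = measure_pmf.prob (map_pmf (\<lambda>(u, v). u \<otimes> v) (pair_pmf (conv_power G p m) (conv_power G p n))) D"
    by simp
  also have "map_pmf (\<lambda>(u, v). u \<otimes> v) (pair_pmf (conv_power G p m) (conv_power G p n)) = conv_power G p (m + n)"
    unfolding conv_power_add[OF assms(1)] pair_pmf_def by (simp add: map_bind_pmf map_pmf_def [symmetric] pmf.map_comp o_def bind_return_pmf map_return_pmf)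
  finally show ?thesis .
qed

lemma semigroup_generated_conv_power:
  assumes "set_pmf p \<subseteq> carrier G" "g \<in> semigroup_generated G (set_pmf p)"
  shows "\<exists>k. g \<in> set_pmf (conv_power G p k)"
  using assms(2)
proof induction
  case (incl g)
  then have "g \<in> set_pmf (conv_power G p 1)" using assms(1) by (force simp: bind_return_pmf)
  then show ?case by blast
next
  case (mult g h)
  then obtain k l where "g \<in> set_pmf (conv_power G p k)" "h \<in> set_pmf (conv_power G p l)" by blast
  then have "g \<otimes> h \<in> set_pmf (conv_power G p (k + l))"
    by (auto simp: conv_power_add[OF assms(1)])
  then show ?case by blast
qed

end

text \<open>
  A probability measure on a countable discrete space that is a subset of its type becomes a
  probability mass function after extension by zero to the whole type.
\<close>

lemma (in prob_space) distr_pmf: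
  assumes "sets M = Pow A" "countable A"
  obtains p where "measure_pmf p = distr M (count_space UNIV) (\<lambda>x. x)"
proof -
  have sp: "space M = A" using sets_eq_imp_space_eq[of M "count_space A"] assms by simp
  have [measurable]: "(\<lambda>x. x) \<in> M \<rightarrow>\<^sub>M count_space UNIV"
    by (rule measurableI) (auto simp: assms sp)
  interpret D: prob_space "distr M (count_space UNIV) (\<lambda>x. x)"
    by (rule prob_space_distr) simp
  have "AE x in distr M (count_space UNIV) (\<lambda>x. x). x \<in> A"
    by (subst AE_distr_iff) (auto simp: sp[symmetric])
  then have "AE x in distr M (count_space UNIV) (\<lambda>x. x). measure (distr M (count_space UNIV) (\<lambda>x. x)) {x} \<noteq> 0"
    using assms(2) by (subst D.AE_support_countable) auto
  then have "measure_pmf (Abs_pmf (distr M (count_space UNIV) (\<lambda>x. x))) = distr M (count_space UNIV) (\<lambda>x. x)"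
    by (intro Abs_pmf_inverse) (simp add: D.prob_space_axioms)
  then show thesis by (rule that)
qed

text \<open>
  Since \<open>Y (n + 1)\<close> is the product of the independent elements \<open>Y n\<close> and \<open>X (n + 1)\<close>, Fubini's theorem
  reproduces the recursion of the convolution powers. Countability makes the multiplication measurable
  for the product \<open>\<sigma>\<close>-algebra.
\<close>

lemma (in group) random_walk_law:
  assumes M: "prob_space M" and \<mu>: "prob_space \<mu>" and sets: "sets \<mu> = Pow (carrier G)"
    and count: "countable (carrier G)"
    and p: "measure_pmf p = distr \<mu> (count_space UNIV) (\<lambda>x. x)"
    and walk: "right_random_walk M G \<mu> Y"
  shows "Y n \<in> M \<rightarrow>\<^sub>M \<mu> \<and> distr M (count_space UNIV) (Y n) = measure_pmf (conv_power G p n)"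
proof -
  interpret M: prob_space M by fact
  interpret \<mu>: prob_space \<mu> by fact
  have sp: "space \<mu> = carrier G" using sets_eq_imp_space_eq[of \<mu> "count_space (carrier G)"] sets by simp
  obtain X where X: "M.indep_vars (\<lambda>_. \<mu>) X {1..}" "\<And>n. n \<ge> 1 \<Longrightarrow> distr M \<mu> (X n) = \<mu>"
    and Y: "\<And>n \<omega>. \<omega> \<in> space M \<Longrightarrow> Y n \<omega> = foldr (\<otimes>) (map (\<lambda>k. X k \<omega>) [1..<Suc n]) \<one>"
    using walk unfolding right_random_walk_def by blast
  have Xm: "X k \<in> M \<rightarrow>\<^sub>M \<mu>" if "k \<ge> 1" for k
    using X(1) that unfolding M.indep_vars_def by auto
  have mult: "(\<lambda>(u, v). u \<otimes> v) \<in> \<mu> \<Otimes>\<^sub>M \<mu> \<rightarrow>\<^sub>M \<mu>"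
  proof -
    have "sets (\<mu> \<Otimes>\<^sub>M \<mu>) = sets (count_space (carrier G) \<Otimes>\<^sub>M count_space (carrier G))"
      using sets by (intro sets_pair_measure_cong) auto
    also have "\<dots> = sets (count_space (carrier G \<times> carrier G))"
      using count by (subst pair_measure_countable) auto
    finally have "measurable (\<mu> \<Otimes>\<^sub>M \<mu>) \<mu> = measurable (count_space (carrier G \<times> carrier G)) \<mu>"
      by (rule measurable_cong_sets) simp
    then show ?thesis using sp by auto
  qed
  have id: "(\<lambda>x. x) \<in> \<mu> \<rightarrow>\<^sub>M count_space UNIV"
    by (rule measurableI) (auto simp: sets sp)
  have foldm: "(\<lambda>f. foldr (\<otimes>) (map f ks) \<one>) \<in> PiM J (\<lambda>_. \<mu>) \<rightarrow>\<^sub>M \<mu>" if "set ks \<subseteq> J" for ks and J :: "nat set"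
    using that
  proof (induction ks)
    case Nil
    then show ?case by (simp add: sp)
  next
    case (Cons k ks)
    have "(\<lambda>f. f k) \<in> PiM J (\<lambda>_. \<mu>) \<rightarrow>\<^sub>M \<mu>" using Cons.prems by (intro measurable_component_singleton) auto
    then have "(\<lambda>f. (f k, foldr (\<otimes>) (map f ks) \<one>)) \<in> PiM J (\<lambda>_. \<mu>) \<rightarrow>\<^sub>M \<mu> \<Otimes>\<^sub>M \<mu>"
      using Cons by (intro measurable_Pair) auto
    from measurable_compose[OF this mult] show ?case by simp
  qed
  define Z where "Z n \<omega> = foldr (\<otimes>) (map (\<lambda>k. X k \<omega>) [1..<Suc n]) \<one>" for n \<omega>
  have Zm: "Z n \<in> M \<rightarrow>\<^sub>M \<mu>" for n
  proof -
    have "(\<lambda>\<omega>. \<lambda>k\<in>{1..n}. X k \<omega>) \<in> M \<rightarrow>\<^sub>M PiM {1..n} (\<lambda>_. \<mu>)"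
      using Xm by (intro measurable_restrict) auto
    from measurable_compose[OF this foldm[of "[1..<Suc n]"]]
    have "(\<lambda>\<omega>. foldr (\<otimes>) (map (\<lambda>k\<in>{1..n}. X k \<omega>) [1..<Suc n]) \<one>) \<in> M \<rightarrow>\<^sub>M \<mu>"
      by (simp del: upt_Suc add: atLeastLessThanSuc_atLeastAtMost)
    moreover have "map (\<lambda>k\<in>{1..n}. X k \<omega>) [1..<Suc n] = map (\<lambda>k. X k \<omega>) [1..<Suc n]" for \<omega>
      by (intro map_cong) auto
    ultimately show ?thesis unfolding Z_def by (simp only:)
  qed
  have ZS: "Z (Suc n) \<omega> = Z n \<omega> \<otimes> X (Suc n) \<omega>" if "\<omega> \<in> space M" for n \<omega>
  proof -
    have "X k \<omega> \<in> carrier G" if "k \<ge> 1" for k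
      using measurable_space[OF Xm[OF that]] \<open>\<omega> \<in> space M\<close> sp by simp
    then show ?thesis
      unfolding Z_def
      by (subst upt_Suc_append) (simp_all add: foldr_mult_append image_subset_iff del: foldr_append upt_Suc)
  qed
  have "distr M (count_space UNIV) (Z n) = measure_pmf (conv_power G p n)"
  proof (induction n)
    case 0
    have "distr M (count_space UNIV) (\<lambda>\<omega>. \<one>) = return (count_space UNIV) \<one>"
      by (rule M.distr_const) simp
    then show ?case by (simp add: Z_def return_pmf.rep_eq)
  next
    case (Suc n)
    have indep: "M.indep_var \<mu> (Z n) \<mu> (X (Suc n))"
    proof -
      have "M.indep_var
          \<mu> ((\<lambda>f. foldr (\<otimes>) (map f [1..<Suc n]) \<one>) \<circ> (\<lambda>\<omega>. restrict (\<lambda>k. X k \<omega>) {1..n}))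
          \<mu> ((\<lambda>f. f (Suc n)) \<circ> (\<lambda>\<omega>. restrict (\<lambda>k. X k \<omega>) {Suc n}))"
        by (intro M.indep_var_compose[OF M.indep_var_restrict[OF X(1)]] foldm measurable_component_singleton) auto
      moreover have "map (\<lambda>k\<in>{1..n}. X k \<omega>) [1..<Suc n] = map (\<lambda>k. X k \<omega>) [1..<Suc n]" for \<omega>
        by (intro map_cong) auto
      then have "(\<lambda>f. foldr (\<otimes>) (map f [1..<Suc n]) \<one>) \<circ> (\<lambda>\<omega>. restrict (\<lambda>k. X k \<omega>) {1..n}) = Z n"
        unfolding Z_def o_def by (simp only:)
      moreover have "(\<lambda>f. f (Suc n)) \<circ> (\<lambda>\<omega>. restrict (\<lambda>k. X k \<omega>) {Suc n}) = X (Suc n)"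
        by auto
      ultimately show ?thesis by (simp only:)
    qed
    show ?case
    proof (rule measure_eqI)
      fix A assume "A \<in> sets (distr M (count_space UNIV) (Z (Suc n)))"
      let ?B = "{z \<in> space (\<mu> \<Otimes>\<^sub>M \<mu>). fst z \<otimes> snd z \<in> A}"
      have A: "A \<inter> carrier G \<in> sets \<mu>" using sets by auto
      have "?B = (\<lambda>(u, v). u \<otimes> v) -` (A \<inter> carrier G) \<inter> space (\<mu> \<Otimes>\<^sub>M \<mu>)"
        by (auto simp: space_pair_measure sp)
      then have B: "?B \<in> sets (\<mu> \<Otimes>\<^sub>M \<mu>)" using measurable_sets[OF mult A] by simp
      have ZX: "(\<lambda>\<omega>. (Z n \<omega>, X (Suc n) \<omega>)) \<in> M \<rightarrow>\<^sub>M \<mu> \<Otimes>\<^sub>M \<mu>"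
        using Zm Xm by (intro measurable_Pair) auto
      have sec: "emeasure \<mu> (Pair u -` ?B) = emeasure (measure_pmf p) ((\<lambda>x. u \<otimes> x) -` A)" if "u \<in> carrier G" for u
      proof -
        have "Pair u -` ?B = (\<lambda>x. u \<otimes> x) -` A \<inter> space \<mu>"
          using that by (auto simp: space_pair_measure sp)
        then show ?thesis unfolding p by (subst emeasure_distr[OF id]) auto
      qed
      have "emeasure (distr M (count_space UNIV) (Z (Suc n))) A = emeasure M (Z (Suc n) -` A \<inter> space M)"
        using measurable_compose[OF Zm id] by (intro emeasure_distr) auto
      also have "Z (Suc n) -` A \<inter> space M = (\<lambda>\<omega>. (Z n \<omega>, X (Suc n) \<omega>)) -` ?B \<inter> space M"
        using measurable_space[OF ZX] by (auto simp: ZS)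
      also have "emeasure M \<dots> = emeasure (distr M (\<mu> \<Otimes>\<^sub>M \<mu>) (\<lambda>\<omega>. (Z n \<omega>, X (Suc n) \<omega>))) ?B"
        using ZX B by (intro emeasure_distr [symmetric])
      also have "distr M (\<mu> \<Otimes>\<^sub>M \<mu>) (\<lambda>\<omega>. (Z n \<omega>, X (Suc n) \<omega>)) = distr M \<mu> (Z n) \<Otimes>\<^sub>M \<mu>"
        using indep X(2)[of "Suc n"] unfolding M.indep_var_distribution_eq by simp
      also have "emeasure (distr M \<mu> (Z n) \<Otimes>\<^sub>M \<mu>) ?B = (\<integral>\<^sup>+u. emeasure \<mu> (Pair u -` ?B) \<partial>distr M \<mu> (Z n))"
        using B by (intro \<mu>.emeasure_pair_measure_alt) (simp cong: sets_pair_measure_cong)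
      also have "\<dots> = (\<integral>\<^sup>+\<omega>. emeasure \<mu> (Pair (Z n \<omega>) -` ?B) \<partial>M)"
        using Zm \<mu>.measurable_emeasure_Pair[OF B] by (intro nn_integral_distr) auto
      also have "\<dots> = (\<integral>\<^sup>+\<omega>. emeasure (measure_pmf p) ((\<lambda>x. Z n \<omega> \<otimes> x) -` A) \<partial>M)"
        using measurable_space[OF Zm] sp by (intro nn_integral_cong sec) auto
      also have "\<dots> = (\<integral>\<^sup>+u. emeasure (measure_pmf p) ((\<lambda>x. u \<otimes> x) -` A) \<partial>distr M (count_space UNIV) (Z n))"
        using measurable_compose[OF Zm id] by (intro nn_integral_distr [symmetric]) auto
      also have "\<dots> = emeasure (measure_pmf (conv_power G p (Suc n))) A"
        by (simp add: Suc)
      finally show "emeasure (distr M (count_space UNIV) (Z (Suc n))) A = emeasure (measure_pmf (conv_power G p (Suc n))) A" .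
    qed simp
  qed
  moreover have "distr M (count_space UNIV) (Y n) = distr M (count_space UNIV) (Z n)"
    by (intro distr_cong) (simp_all add: Y Z_def)
  moreover have "Y n \<in> M \<rightarrow>\<^sub>M \<mu>"
    using Zm[of n] by (subst measurable_cong[where g = "Z n"]) (simp_all add: Y Z_def)
  ultimately show ?thesis by simp
qed


section \<open>Approximately superadditive sequences of laws\<close>

lemma eventually_le_linear:
  fixes c d :: real
  assumes "0 < d"
  shows "\<forall>\<^sub>F n in sequentially. c \<le> real n * d"
  using assms by real_asymp

lemma rounding_error:
  fixes a t n N K :: real
  assumes "a \<le> t * n" "t * n - 1 \<le> a" "n \<le> N + 2" "N \<le> n + K" "0 \<le> t" "t \<le> 1" "0 \<le> K"
  shows "\<bar>a - t * N\<bar> \<le> K + 3"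
proof -
  have "t * n \<le> t * (N + 2)" "t * N \<le> t * (n + K)"
    using assms by (intro mult_left_mono; simp)+
  moreover have "t * K \<le> 1 * K" using assms by (intro mult_right_mono) auto
  ultimately have "a - t * N \<le> K + 3" "t * N - a \<le> K + 3"
    using assms unfolding distrib_left by linarith+
  then show ?thesis by (simp add: abs_le_iff)
qed

lemma ext_log_ge:
  assumes "n > 0" "exp (- h * real n) \<le> p"
  shows "ereal (- h) \<le> ereal (1 / real n) * ext_log p"
proof -
  have "p > 0" using assms(2) less_le_trans[OF exp_gt_zero] by blast
  then have "- h * real n \<le> ln p" using assms(2) by (simp add: ln_ge_iff)
  then show ?thesis using assms(1) \<open>p > 0\<close> by (simp add: ext_log_def field_simps)
qed

lemma ext_log_le:
  assumes "n > 0" "0 \<le> p" "0 < b" "p \<le> b * exp (- h * real n)"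
  shows "ereal (1 / real n) * ext_log p \<le> ereal (ln b / real n - h)"
proof (cases "p = 0")
  case True
  then show ?thesis using assms(1) by (simp add: ext_log_def)
next
  case False
  then have "ln p \<le> ln (b * exp (- h * real n))"
    using assms by simp
  also have "\<dots> = ln b - h * real n" using assms by (simp add: ln_mult)
  finally show ?thesis using assms(1) False by (simp add: ext_log_def field_simps)
qed

text \<open>
  \<open>Q n\<close> is the law of a random length at time \<open>n\<close>. The assumption \<open>concat\<close> says that two independent
  pieces can be joined at a bounded cost in time, length and probability. The assumption \<open>pad\<close> allows a
  remaining time \<open>j\<close> to be filled at a cost linear in \<open>j\<close>, which is how times that are not multiples of
  a block length are reached.
\<close>

locale approx_superadditive =
  fixes Q :: "nat \<Rightarrow> real pmf" and K :: nat and C \<gamma> \<sigma> \<kappa> :: real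
  assumes C_nonneg: "0 \<le> C" and gamma_nonneg: "0 \<le> \<gamma>" and sigma_nonneg: "0 \<le> \<sigma>" and kappa_nonneg: "0 \<le> \<kappa>"
    and start: "Q 0 = return_pmf 0"
    and concat: "\<And>m n a b d e. exp (- \<gamma>) * measure_pmf.prob (Q m) (cball a d) * measure_pmf.prob (Q n) (cball b e)
                   \<le> measure_pmf.prob (Q (m + n + K)) (cball (a + b) (d + e + C))"
    and pad: "\<And>m j a d. exp (- \<kappa> * real j) * measure_pmf.prob (Q m) (cball a d)
                   \<le> measure_pmf.prob (Q (m + j)) (cball a (d + \<sigma> * real j))"
begin

definition near :: "nat \<Rightarrow> real \<Rightarrow> real \<Rightarrow> real" where
  "near n x \<epsilon> = measure_pmf.prob (Q n) (cball (real n * x) (real n * \<epsilon>))"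

definition attainable :: "real \<Rightarrow> real \<Rightarrow> bool" where
  "attainable x h \<longleftrightarrow> (\<forall>\<epsilon>>0. \<exists>\<^sub>F n in sequentially. exp (- h * real n) \<le> near n x \<epsilon>)"

definition rate :: "real \<Rightarrow> ereal" where
  "rate x = (INF h\<in>{h. attainable x h}. ereal h)"

text \<open>
  Joining \<open>k\<close> copies of a block of length \<open>n\<close>, each followed by a junction of length \<open>K\<close>: both the
  error in the length and the exponent only grow linearly in \<open>k\<close>.
\<close>

lemma blocks:
  assumes "exp (- h * real n) \<le> near n x \<epsilon>"
  shows "exp (- (\<gamma> + h * real n) * real k)
           \<le> measure_pmf.prob (Q (k * (n + K))) (cball (real k * (real n * x)) (real k * (real n * \<epsilon> + C)))"
proof (induction k)
  case 0
  show ?case by (simp add: start)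
next
  case (Suc k)
  have "exp (- (\<gamma> + h * real n) * real (Suc k))
      = exp (- \<gamma>) * exp (- (\<gamma> + h * real n) * real k) * exp (- h * real n)"
    by (simp add: exp_add [symmetric] algebra_simps)
  also have "\<dots> \<le> exp (- \<gamma>) *
      measure_pmf.prob (Q (k * (n + K))) (cball (real k * (real n * x)) (real k * (real n * \<epsilon> + C))) *
      measure_pmf.prob (Q n) (cball (real n * x) (real n * \<epsilon>))"
    using Suc.IH assms unfolding near_def by (intro mult_mono) auto
  also have "\<dots> \<le> measure_pmf.prob (Q (k * (n + K) + n + K))
      (cball (real k * (real n * x) + real n * x) (real k * (real n * \<epsilon> + C) + real n * \<epsilon> + C))"
    by (rule concat)
  finally show ?case by (simp add: algebra_simps)
qed

lemma attainable_nonneg: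
  assumes "attainable x h" shows "0 \<le> h"
proof (rule ccontr)
  assume "\<not> 0 \<le> h"
  have "\<exists>\<^sub>F n in sequentially. exp (- h * real n) \<le> near n x 1 \<and> n > 0"
    using assms unfolding attainable_def
    by (intro frequently_eventually_frequently eventually_gt_at_top) auto
  then obtain n where "exp (- h * real n) \<le> near n x 1" "n > 0"
    using frequently_ex by blast
  moreover have "near n x 1 \<le> 1" by (simp add: near_def)
  ultimately have "exp (- h * real n) \<le> 1" by linarith
  then have "- h * real n \<le> 0" by simp
  moreover have "- h * real n > 0" using \<open>n > 0\<close> \<open>\<not> 0 \<le> h\<close> by (intro mult_pos_pos) auto
  ultimately show False by linarith
qed

lemma attainable_mono:
  assumes "attainable x h" "h \<le> h'" shows "attainable x h'"
  unfolding attainable_def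
proof (intro allI impI)
  fix \<epsilon> :: real assume "\<epsilon> > 0"
  then have "\<exists>\<^sub>F n in sequentially. exp (- h * real n) \<le> near n x \<epsilon>"
    using assms unfolding attainable_def by blast
  moreover have "exp (- h' * real n) \<le> exp (- h * real n)" for n
    using assms(2) by (simp add: mult_right_mono)
  ultimately show "\<exists>\<^sub>F n in sequentially. exp (- h' * real n) \<le> near n x \<epsilon>"
    by (elim frequently_elim1) (rule order_trans)
qed

text \<open>
  This is the analogue of Fekete's lemma. Choose one good block length \<open>n\<close>, so large that the
  costs \<open>K\<close>, \<open>C\<close>, \<open>\<gamma>\<close> of a junction are negligible compared with \<open>n\<close>. Divide an arbitrary large time
  \<open>N\<close> by \<open>n + K\<close> with remainder, fill the quotient with good blocks and the remainder by padding.
\<close>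

lemma attainable_eventually:
  assumes att: "attainable x h" and "h < h'" and "\<epsilon> > 0"
  shows "\<forall>\<^sub>F N in sequentially. exp (- h' * real N) \<le> near N x \<epsilon>"
proof -
  have h0: "0 \<le> h" using att by (rule attainable_nonneg)
  \<comment> \<open>The radius \<open>\<epsilon>\<close> is divided into \<open>\<epsilon> / 2\<close> for the blocks, \<open>\<epsilon> / 4\<close> for the junctions and \<open>\<epsilon> / 4\<close>
      for the remainder; the excess \<open>h' - h\<close> is shared by the junctions and the remainder.\<close>
  have large: "\<forall>\<^sub>F n in sequentially. C + real K * \<bar>x\<bar> \<le> real n * (\<epsilon> / 4) \<and>
      \<gamma> \<le> real n * ((h' - h) / 2) \<and> n > 0"
  proof (intro eventually_conj eventually_gt_at_top)
    show "\<forall>\<^sub>F n in sequentially. C + real K * \<bar>x\<bar> \<le> real n * (\<epsilon> / 4)"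
      using \<open>\<epsilon> > 0\<close> by (intro eventually_le_linear) simp
    show "\<forall>\<^sub>F n in sequentially. \<gamma> \<le> real n * ((h' - h) / 2)"
      using \<open>h < h'\<close> by (intro eventually_le_linear) simp
  qed
  have "\<exists>\<^sub>F n in sequentially. exp (- h * real n) \<le> near n x (\<epsilon> / 2)"
    using att \<open>\<epsilon> > 0\<close> unfolding attainable_def by simp
  from frequently_ex[OF frequently_eventually_frequently[OF this large]]
obtain n where n: "exp (- h * real n) \<le> near n x (\<epsilon> / 2)" "n > 0"
      "C + real K * \<bar>x\<bar> \<le> real n * (\<epsilon> / 4)" "\<gamma> \<le> real n * ((h' - h) / 2)"
    by blast
  define m where "m = n + K"
  have "m > 0" using n(2) by (simp add: m_def)
  have "\<forall>\<^sub>F N in sequentially. real m * (\<sigma> + \<bar>x\<bar>) \<le> real N * (\<epsilon> / 4) \<and>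
      real m * \<kappa> \<le> real N * ((h' - h) / 2)"
    using assms by (intro eventually_conj eventually_le_linear) auto
  then show ?thesis
  proof (rule eventually_mono, elim conjE)
    fix N
    assume N: "real m * (\<sigma> + \<bar>x\<bar>) \<le> real N * (\<epsilon> / 4)" "real m * \<kappa> \<le> real N * ((h' - h) / 2)"
    define k j where "k = N div m" and "j = N mod m"
    have Nkj: "N = k * (n + K) + j" and "j < m"
      using \<open>m > 0\<close> by (simp_all add: k_def j_def m_def [symmetric])
    have N': "real N = real k * real n + real k * real K + real j"
      by (simp add: Nkj algebra_simps)
    have kn: "real k * real n \<le> real N" by (simp add: N')
    have "(\<gamma> + h * real n) * real k + \<kappa> * real j \<le> h' * real N"
    proof -
      have "\<gamma> * real k \<le> real n * ((h' - h) / 2) * real k"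
        using n(4) by (intro mult_right_mono) auto
      also have "\<dots> = (real k * real n) * ((h' - h) / 2)" by simp
      also have "\<dots> \<le> real N * ((h' - h) / 2)"
        using kn \<open>h < h'\<close> by (intro mult_right_mono) auto
      finally have 1: "\<gamma> * real k \<le> real N * ((h' - h) / 2)" .
      have "\<kappa> * real j \<le> \<kappa> * real m"
        using \<open>j < m\<close> kappa_nonneg by (intro mult_left_mono) auto
      then have 2: "\<kappa> * real j \<le> real N * ((h' - h) / 2)"
        using N(2) by (simp add: mult.commute)
      have 3: "h * (real k * real n) \<le> h * real N"
        using kn h0 by (intro mult_left_mono) auto
      show ?thesis using 1 2 3 by (simp add: algebra_simps)
    qed
    then have "exp (- h' * real N) \<le> exp (- \<kappa> * real j) * exp (- (\<gamma> + h * real n) * real k)"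
      by (simp add: exp_add [symmetric] algebra_simps)
    also have "\<dots> \<le> exp (- \<kappa> * real j) * measure_pmf.prob (Q (k * (n + K)))
        (cball (real k * (real n * x)) (real k * (real n * (\<epsilon> / 2) + C)))"
      using blocks[OF n(1)] by (intro mult_left_mono) auto
    also have "\<dots> \<le> measure_pmf.prob (Q N)
        (cball (real k * (real n * x)) (real k * (real n * (\<epsilon> / 2) + C) + \<sigma> * real j))"
      unfolding Nkj by (rule pad)
    also have "\<dots> \<le> near N x \<epsilon>"
      unfolding near_def
    proof (rule measure_pmf.finite_measure_mono)
      have "real N * x - real k * (real n * x) = (real k * real K + real j) * x"
        by (simp add: N' algebra_simps)
      then have "dist (real k * (real n * x)) (real N * x) = (real k * real K + real j) * \<bar>x\<bar>"
        by (simp add: dist_real_def abs_minus_commute abs_mult)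
      moreover have "(real k * real K + real j) * \<bar>x\<bar> + (real k * (real n * (\<epsilon> / 2) + C) + \<sigma> * real j)
           \<le> real N * \<epsilon>"
      proof -
        have "real k * (C + real K * \<bar>x\<bar>) \<le> real k * (real n * (\<epsilon> / 4))"
          using n(3) by (intro mult_left_mono) auto
        moreover have "real k * real n * (\<epsilon> * (3 / 4)) \<le> real N * (\<epsilon> * (3 / 4))"
          using kn \<open>\<epsilon> > 0\<close> by (intro mult_right_mono) auto
        moreover have "real j * (\<sigma> + \<bar>x\<bar>) \<le> real m * (\<sigma> + \<bar>x\<bar>)"
          using \<open>j < m\<close> sigma_nonneg by (intro mult_right_mono) auto
        ultimately show ?thesis using N(1) by (simp add: algebra_simps)
      qed
      ultimately show "cball (real k * (real n * x)) (real k * (real n * (\<epsilon> / 2) + C) + \<sigma> * real j)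
          \<subseteq> cball (real N * x) (real N * \<epsilon>)"
        by (auto simp: cball_subset_cball_iff)
    qed simp
    finally show "exp (- h' * real N) \<le> near N x \<epsilon>" .
  qed
qed

text \<open>
  Run at speed \<open>x\<close> during the fraction \<open>1 - t\<close> of the time and at speed \<open>y\<close> during the rest. The
  lower bounds are needed at the two specific times \<open>\<lfloor>(1 - t) n\<rfloor>\<close> and \<open>\<lfloor>t n\<rfloor>\<close> simultaneously,
  which is why \<open>attainable_eventually\<close> is applied first; the total time \<open>\<lfloor>(1 - t) n\<rfloor> + \<lfloor>t n\<rfloor> + K\<close>
  still runs through infinitely many values, which is all that attainability asks for.
\<close>

lemma attainable_convex:
  assumes "attainable x h" "attainable y k" "0 < t" "t < 1" "\<eta> > 0"
  shows "attainable ((1 - t) * x + t * y) ((1 - t) * h + t * k + \<eta>)"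
  unfolding attainable_def
proof (intro allI impI)
  fix \<epsilon> :: real assume "\<epsilon> > 0"
  define z where "z = (1 - t) * x + t * y"
  define a b where "a n = nat \<lfloor>(1 - t) * real n\<rfloor>" and "b n = nat \<lfloor>t * real n\<rfloor>" for n
  have ab: "real (a n) \<le> (1 - t) * real n" "(1 - t) * real n - 1 \<le> real (a n)"
    "real (b n) \<le> t * real n" "t * real n - 1 \<le> real (b n)" for n
    using assms by (auto simp: a_def b_def)
  have lim: "filterlim a sequentially sequentially" "filterlim b sequentially sequentially"
    unfolding a_def b_def using assms by real_asymp+
  define N where "N n = a n + b n + K" for n
  have limN: "filterlim N sequentially sequentially"
    unfolding N_def by (rule filterlim_at_top_mono[OF lim(1)]) simp
  have hk: "0 \<le> h" "0 \<le> k" using assms attainable_nonneg by auto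
  have "\<forall>\<^sub>F n in sequentially. exp (- (h + \<eta> / 2) * real n) \<le> near n x (\<epsilon> / 2)"
    by (rule attainable_eventually[OF assms(1)]) (use \<open>\<epsilon> > 0\<close> \<open>\<eta> > 0\<close> in auto)
  then have ev1: "\<forall>\<^sub>F n in sequentially. exp (- (h + \<eta> / 2) * real (a n)) \<le> near (a n) x (\<epsilon> / 2)"
    using lim(1) by (rule eventually_compose_filterlim)
  have "\<forall>\<^sub>F n in sequentially. exp (- (k + \<eta> / 2) * real n) \<le> near n y (\<epsilon> / 2)"
    by (rule attainable_eventually[OF assms(2)]) (use \<open>\<epsilon> > 0\<close> \<open>\<eta> > 0\<close> in auto)
  then have ev2: "\<forall>\<^sub>F n in sequentially. exp (- (k + \<eta> / 2) * real (b n)) \<le> near (b n) y (\<epsilon> / 2)"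
    using lim(2) by (rule eventually_compose_filterlim)
  \<comment> \<open>\<open>D\<close> bounds the error in length that is caused by rounding the times and by the junction; \<open>H\<close> is the
      cost per unit of time of the two pieces, so that a margin \<open>\<eta> / 2\<close> per unit remains for \<open>\<gamma>\<close>.\<close>
  define D where "D = C + (real K + 3) * (\<bar>x\<bar> + \<bar>y\<bar>)"
  define H where "H = (1 - t) * h + t * k + \<eta> / 2"
  have "\<forall>\<^sub>F n in sequentially. D \<le> real n * (\<epsilon> / 2) \<and> \<gamma> + 2 * H \<le> real n * (\<eta> / 2)"
    using \<open>\<epsilon> > 0\<close> \<open>\<eta> > 0\<close> by (intro eventually_conj eventually_le_linear) auto
  then have "\<forall>\<^sub>F n in sequentially. D \<le> real (N n) * (\<epsilon> / 2) \<and> \<gamma> + 2 * H \<le> real (N n) * (\<eta> / 2)"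
    using limN by (rule eventually_compose_filterlim)
  with ev1 ev2 have "\<forall>\<^sub>F n in sequentially. exp (- ((1 - t) * h + t * k + \<eta>) * real (N n)) \<le> near (N n) z \<epsilon>"
  proof eventually_elim
    case (elim n)
    have Nn: "real n \<le> real (N n) + 2" "real (N n) \<le> real n + real K"
      "real (N n) = real (a n) + real (b n) + real K"
      using ab[of n] by (auto simp: N_def algebra_simps)
    have "(h + \<eta> / 2) * real (a n) \<le> (h + \<eta> / 2) * ((1 - t) * (real (N n) + 2))"
    proof (rule mult_left_mono)
      have "(1 - t) * real n \<le> (1 - t) * (real (N n) + 2)"
        using Nn(1) \<open>t < 1\<close> by (intro mult_left_mono) auto
      then show "real (a n) \<le> (1 - t) * (real (N n) + 2)" using ab(1)[of n] by linarith
    qed (use hk \<open>\<eta> > 0\<close> in simp)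
    moreover have "(k + \<eta> / 2) * real (b n) \<le> (k + \<eta> / 2) * (t * (real (N n) + 2))"
    proof (rule mult_left_mono)
      have "t * real n \<le> t * (real (N n) + 2)"
        using Nn(1) \<open>0 < t\<close> by (intro mult_left_mono) auto
      then show "real (b n) \<le> t * (real (N n) + 2)" using ab(3)[of n] by linarith
    qed (use hk \<open>\<eta> > 0\<close> in simp)
    moreover have "(h + \<eta> / 2) * ((1 - t) * (real (N n) + 2)) + (k + \<eta> / 2) * (t * (real (N n) + 2))
        = H * real (N n) + 2 * H"
      by (simp add: H_def algebra_simps)
    moreover have "((1 - t) * h + t * k + \<eta>) * real (N n) = H * real (N n) + real (N n) * (\<eta> / 2)"
      by (simp add: H_def algebra_simps)
    ultimately have "\<gamma> + (h + \<eta> / 2) * real (a n) + (k + \<eta> / 2) * real (b n)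
        \<le> ((1 - t) * h + t * k + \<eta>) * real (N n)"
      using elim(3) by linarith
    then have "exp (- ((1 - t) * h + t * k + \<eta>) * real (N n)) \<le>
        exp (- \<gamma> + - (h + \<eta> / 2) * real (a n) + - (k + \<eta> / 2) * real (b n))"
      unfolding exp_le_cancel_iff by linarith
    also have "\<dots> = exp (- \<gamma>) * exp (- (h + \<eta> / 2) * real (a n)) * exp (- (k + \<eta> / 2) * real (b n))"
      by (simp only: exp_add)
    also have "\<dots> \<le> exp (- \<gamma>) * near (a n) x (\<epsilon> / 2) * near (b n) y (\<epsilon> / 2)"
      using elim(1,2) by (intro mult_mono) (auto simp: near_def)
    also have "\<dots> \<le> measure_pmf.prob (Q (N n)) (cball (real (a n) * x + real (b n) * y)
        (real (a n) * (\<epsilon> / 2) + real (b n) * (\<epsilon> / 2) + C))"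
      unfolding near_def N_def by (rule concat)
    also have "\<dots> \<le> near (N n) z \<epsilon>"
      unfolding near_def
    proof (rule measure_pmf.finite_measure_mono)
      have 1: "\<bar>real (a n) - (1 - t) * real (N n)\<bar> \<le> real K + 3"
          "\<bar>real (b n) - t * real (N n)\<bar> \<le> real K + 3"
        using ab[of n] Nn assms(3,4) by (auto intro!: rounding_error[of _ _ "real n"])
      have "dist (real (a n) * x + real (b n) * y) (real (N n) * z)
          = \<bar>(real (a n) - (1 - t) * real (N n)) * x + (real (b n) - t * real (N n)) * y\<bar>"
        by (simp add: dist_real_def z_def algebra_simps)
      also have "\<dots> \<le> \<bar>real (a n) - (1 - t) * real (N n)\<bar> * \<bar>x\<bar> + \<bar>real (b n) - t * real (N n)\<bar> * \<bar>y\<bar>"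
        by (metis abs_mult abs_triangle_ineq)
      also have "\<dots> \<le> (real K + 3) * \<bar>x\<bar> + (real K + 3) * \<bar>y\<bar>"
        using 1 by (intro add_mono mult_right_mono) auto
      finally have "dist (real (a n) * x + real (b n) * y) (real (N n) * z) + C \<le> D"
        by (simp add: D_def algebra_simps)
      moreover have "real (a n) * (\<epsilon> / 2) + real (b n) * (\<epsilon> / 2) \<le> real (N n) * (\<epsilon> / 2)"
        using \<open>\<epsilon> > 0\<close> by (simp add: Nn(3) algebra_simps)
      ultimately show "cball (real (a n) * x + real (b n) * y) (real (a n) * (\<epsilon> / 2) + real (b n) * (\<epsilon> / 2) + C)
          \<subseteq> cball (real (N n) * z) (real (N n) * \<epsilon>)"
        using elim(3) by (auto simp: cball_subset_cball_iff)
    qed simp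
    finally show ?case .
  qed
  then have "\<exists>\<^sub>F n in sequentially. exp (- ((1 - t) * h + t * k + \<eta>) * real (N n)) \<le> near (N n) z \<epsilon>"
    by (simp add: eventually_frequently)
  then show "\<exists>\<^sub>F n in sequentially. exp (- ((1 - t) * h + t * k + \<eta>) * real n)
           \<le> near n ((1 - t) * x + t * y) \<epsilon>"
    unfolding z_def frequently_def using limN by (blast dest: eventually_compose_filterlim)
qed

lemma rate_nonneg: "0 \<le> rate x"
  unfolding rate_def by (rule INF_greatest) (auto simp: attainable_nonneg)

lemma rate_less_iff: "rate x < ereal h \<longleftrightarrow> (\<exists>h'<h. attainable x h')"
  unfolding rate_def by (auto simp: INF_less_iff)

lemma rate_geI: "\<not> attainable x h \<Longrightarrow> ereal h \<le> rate x"
  unfolding not_less [symmetric] rate_less_iff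
  using attainable_mono less_imp_le by blast

lemma near_small:
  assumes "ereal h < rate x"
  obtains \<epsilon> where "\<epsilon> > 0" "\<forall>\<^sub>F n in sequentially. near n x \<epsilon> < exp (- h * real n)"
proof -
  have "\<not> attainable x h"
    using assms unfolding rate_def by (metis INF_lower leD mem_Collect_eq)
  then show thesis
    using that unfolding attainable_def by (auto simp: not_frequently not_le)
qed


text \<open>
  Non-attainability of \<open>h\<close> at \<open>x\<close> is witnessed by a ball around \<open>x\<close>, hence shared by nearby points.
\<close>

lemma open_rate_greater: "open {x. a < rate x}"
proof (rule openI)
  fix x assume "x \<in> {x. a < rate x}"
  then have "a < rate x" by simp
  then obtain h where h: "a < ereal h" "ereal h < rate x"
    using ereal_dense2 by blast
  obtain \<epsilon> where \<epsilon>: "\<epsilon> > 0" "\<forall>\<^sub>F n in sequentially. near n x \<epsilon> < exp (- h * real n)"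
    using near_small[OF h(2)] .
  have "a < rate y" if "y \<in> ball x (\<epsilon> / 2)" for y
  proof -
    have "near n y (\<epsilon> / 2) \<le> near n x \<epsilon>" for n
      unfolding near_def
    proof (rule measure_pmf.finite_measure_mono)
      have "dist (real n * y) (real n * x) = real n * dist x y"
        by (simp add: dist_real_def abs_minus_commute abs_mult flip: right_diff_distrib)
      also have "\<dots> \<le> real n * (\<epsilon> / 2)"
        using that by (intro mult_left_mono) auto
      finally show "cball (real n * y) (real n * (\<epsilon> / 2)) \<subseteq> cball (real n * x) (real n * \<epsilon>)"
        by (auto simp: cball_subset_cball_iff)
    qed simp
    then have "\<forall>\<^sub>F n in sequentially. \<not> exp (- h * real n) \<le> near n y (\<epsilon> / 2)"
      using \<epsilon>(2) by (auto elim!: eventually_mono simp: not_le intro: le_less_trans)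
    then have "\<not> attainable y h"
      using \<open>\<epsilon> > 0\<close> unfolding attainable_def by (auto simp: frequently_def intro!: exI[of _ "\<epsilon> / 2"])
    then show ?thesis using h(1) rate_geI less_le_trans by blast
  qed
  then show "\<exists>e>0. ball x e \<subseteq> {x. a < rate x}"
    using \<open>\<epsilon> > 0\<close> by (intro exI[of _ "\<epsilon> / 2"]) auto
qed

lemma rate_convex:
  assumes "0 \<le> t" "t \<le> 1"
  shows "rate ((1 - t) * x + t * y) \<le> ereal (1 - t) * rate x + ereal t * rate y"
  \<comment> \<open>At the end points the convention \<open>0 \<cdot> \<infinity> = 0\<close> reduces the claim to reflexivity; for \<open>0 < t < 1\<close> an
      infinite rate makes the right-hand side infinite.\<close>
proof (cases "t = 0 \<or> t = 1 \<or> rate x = \<infinity> \<or> rate y = \<infinity>")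
  case True
  then show ?thesis
    using assms rate_nonneg[of x] rate_nonneg[of y] by (auto simp flip: zero_ereal_def one_ereal_def)
next
  case False
  then have t: "0 < t" "t < 1" using assms by auto
  obtain p q where pq: "rate x = ereal p" "rate y = ereal q"
    using False rate_nonneg[of x] rate_nonneg[of y] by (cases "rate x"; cases "rate y") auto
  have "rate ((1 - t) * x + t * y) \<le> ereal ((1 - t) * p + t * q) + ereal e" if "e > 0" for e
  proof -
    have "rate x < ereal (p + e / 2)" "rate y < ereal (q + e / 2)"
      using pq \<open>e > 0\<close> by simp_all
    then obtain h k where hk: "h < p + e / 2" "attainable x h" "k < q + e / 2" "attainable y k"
      unfolding rate_less_iff by blast
    have "attainable ((1 - t) * x + t * y) ((1 - t) * h + t * k + e / 2)"
      using attainable_convex[OF hk(2,4) t] \<open>e > 0\<close> by simp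
    then have "rate ((1 - t) * x + t * y) \<le> ereal ((1 - t) * h + t * k + e / 2)"
      unfolding rate_def by (intro INF_lower) simp
    also have "(1 - t) * h + t * k + e / 2 \<le> (1 - t) * (p + e / 2) + t * (q + e / 2) + e / 2"
      using hk t by (intro add_mono mult_left_mono) auto
    also have "\<dots> = (1 - t) * p + t * q + e"
      by (simp add: field_simps)
    finally show ?thesis by simp
  qed
  then have "rate ((1 - t) * x + t * y) \<le> ereal ((1 - t) * p + t * q)"
    by (rule ereal_le_epsilon2[rule_format])
  then show ?thesis by (simp add: pq)
qed

lemma lower_bound:
  assumes "open U" "x \<in> U"
  shows "- rate x \<le> liminf (\<lambda>n. ereal (1 / real n) * ext_log (measure_pmf.prob (Q n) {s. s / real n \<in> U}))"
    (is "_ \<le> liminf ?f")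
proof -
  have "- liminf ?f \<le> rate x"
  proof (rule dense_ge)
    fix w assume "rate x < w"
    then obtain h where h: "rate x < ereal h" "ereal h < w" using ereal_dense2 by blast
    then obtain h' where h': "attainable x h'" "h' < h" unfolding rate_less_iff by blast
    obtain \<epsilon> where \<epsilon>: "\<epsilon> > 0" "cball x \<epsilon> \<subseteq> U"
      using assms open_contains_cball by blast
    have "\<forall>\<^sub>F n in sequentially. ereal (- h) \<le> ?f n"
      using attainable_eventually[OF h' \<epsilon>(1)] eventually_gt_at_top[of 0]
    proof eventually_elim
      case (elim n)
      have "near n x \<epsilon> \<le> measure_pmf.prob (Q n) {s. s / real n \<in> U}"
        unfolding near_def
      proof (rule measure_pmf.finite_measure_mono)
        show "cball (real n * x) (real n * \<epsilon>) \<subseteq> {s. s / real n \<in> U}"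
        proof
          fix s assume "s \<in> cball (real n * x) (real n * \<epsilon>)"
          then have "\<bar>real n * x - s\<bar> / real n \<le> \<epsilon>"
            using elim(2) by (simp add: dist_real_def field_simps)
          moreover have "x - s / real n = (real n * x - s) / real n"
            using elim(2) by (simp add: field_simps)
          ultimately show "s \<in> {s. s / real n \<in> U}"
            using \<epsilon>(2) by (auto simp: dist_real_def abs_divide)
        qed
      qed simp
      with elim(1) show ?case by (rule ext_log_ge[OF elim(2) order_trans])
    qed
    then have "ereal (- h) \<le> liminf ?f" by (rule Liminf_bounded)
    then have "- liminf ?f \<le> - ereal (- h)" by (rule iffD2[OF ereal_minus_le_minus])
    also have "\<dots> \<le> w" using h(2) by simp
    finally show "- liminf ?f \<le> w" .
  qed
  then show ?thesis by (rule iffD1[OF ereal_uminus_le_reorder])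
qed

text \<open>
  For \<open>h\<close> below the infimum of the rate, each point of the compact set has a ball of probability below
  \<open>exp (- h n)\<close> for large \<open>n\<close>; finitely many of these balls cover the set, and their number disappears
  on the exponential scale.
\<close>

lemma upper_bound:
  assumes "compact A"
  shows "limsup (\<lambda>n. ereal (1 / real n) * ext_log (measure_pmf.prob (Q n) {s. s / real n \<in> A})) \<le> - (INF x\<in>A. rate x)"
    (is "limsup ?f \<le> _")
proof -
  have "(INF x\<in>A. rate x) \<le> - limsup ?f"
  proof (rule dense_le)
    fix w assume "w < (INF x\<in>A. rate x)"
    then obtain h where h: "w < ereal h" "ereal h < (INF x\<in>A. rate x)" using ereal_dense2 by blast
    have "\<exists>\<epsilon>>0. \<forall>\<^sub>F n in sequentially. near n x \<epsilon> < exp (- h * real n)" if "x \<in> A" for x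
    proof -
      have "ereal h < rate x" using h(2) that by (meson INF_lower less_le_trans)
      then show ?thesis using near_small by blast
    qed
    then obtain \<epsilon> where \<epsilon>: "\<And>x. x \<in> A \<Longrightarrow> \<epsilon> x > 0"
        "\<And>x. x \<in> A \<Longrightarrow> \<forall>\<^sub>F n in sequentially. near n x (\<epsilon> x) < exp (- h * real n)"
      by metis
    obtain B where B: "B \<subseteq> A" "finite B" "A \<subseteq> (\<Union>x\<in>B. ball x (\<epsilon> x))"
      using compactE_image[OF assms, of A "\<lambda>x. ball x (\<epsilon> x)"] \<epsilon>(1) by (metis (no_types, lifting) UN_I centre_in_ball open_ball subsetI)
    have "\<forall>\<^sub>F n in sequentially. \<forall>x\<in>B. near n x (\<epsilon> x) < exp (- h * real n)"
      using B \<epsilon>(2) by (intro eventually_ball_finite) auto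
    then have "\<forall>\<^sub>F n in sequentially. ?f n \<le> ereal (ln (real (Suc (card B))) / real n - h)"
      using eventually_gt_at_top[of 0]
    proof eventually_elim
      case (elim n)
      have "{s. s / real n \<in> A} \<subseteq> (\<Union>x\<in>B. cball (real n * x) (real n * \<epsilon> x))"
      proof
        fix s assume "s \<in> {s. s / real n \<in> A}"
        then obtain x where "x \<in> B" "dist x (s / real n) < \<epsilon> x" using B(3) by auto
        then have "\<bar>x - s / real n\<bar> * real n \<le> \<epsilon> x * real n"
          by (intro mult_right_mono) (auto simp: dist_real_def)
        moreover have "\<bar>x - s / real n\<bar> * real n = \<bar>real n * x - s\<bar>"
        proof -
          have "\<bar>x - s / real n\<bar> * real n = \<bar>(x - s / real n) * real n\<bar>" by (simp add: abs_mult)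
          also have "(x - s / real n) * real n = real n * x - s" using elim(2) by (simp add: field_simps)
          finally show ?thesis .
        qed
        ultimately show "s \<in> (\<Union>x\<in>B. cball (real n * x) (real n * \<epsilon> x))"
          using \<open>x \<in> B\<close> by (auto simp: dist_real_def mult.commute)
      qed
      then have "measure_pmf.prob (Q n) {s. s / real n \<in> A}
          \<le> measure_pmf.prob (Q n) (\<Union>x\<in>B. cball (real n * x) (real n * \<epsilon> x))"
        by (intro measure_pmf.finite_measure_mono) auto
      also have "\<dots> \<le> (\<Sum>x\<in>B. near n x (\<epsilon> x))"
        unfolding near_def by (intro measure_pmf.finite_measure_subadditive_finite B) auto
      also have "\<dots> \<le> (\<Sum>x\<in>B. exp (- h * real n))"
        using elim(1) by (intro sum_mono) (auto intro: less_imp_le)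
      also have "\<dots> \<le> real (Suc (card B)) * exp (- h * real n)"
        by simp
      \<comment> \<open>\<open>Suc\<close> keeps the logarithm meaningful when \<open>A\<close>, and with it \<open>B\<close>, is empty.\<close>
      finally show ?case using elim(2) by (intro ext_log_le) auto
    qed
    then have "limsup ?f \<le> limsup (\<lambda>n. ereal (ln (real (Suc (card B))) / real n - h))"
      by (rule Limsup_mono)
    also have "\<dots> = ereal (- h)"
    proof (rule lim_imp_Limsup)
      show "(\<lambda>n. ereal (ln (real (Suc (card B))) / real n - h)) \<longlonglongrightarrow> ereal (- h)"
      proof (rule tendsto_ereal)
        show "(\<lambda>n. ln (real (Suc (card B))) / real n - h) \<longlonglongrightarrow> - h"
          using tendsto_diff[OF lim_const_over_n[of "ln (real (Suc (card B)))"] tendsto_const[of h]] by simp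
      qed
    qed simp
    finally have "limsup ?f \<le> ereal (- h)" .
    then have "- ereal (- h) \<le> - limsup ?f" by (rule iffD2[OF ereal_minus_le_minus])
    moreover have "w \<le> - ereal (- h)" using h(1) by simp
    ultimately show "w \<le> - limsup ?f" by (rule order_trans[rotated])
  qed
  then have "- (- limsup ?f) \<le> - (INF x\<in>A. rate x)" by (rule iffD2[OF ereal_minus_le_minus])
  then show ?thesis by simp
qed

end

section \<open>The walk on a free product\<close>

context fg_free_product
begin

abbreviation len :: "('i \<times> 'a) list \<Rightarrow> real" where
  "len w \<equiv> real (word_length F SF w)"

lemma starts_in_factor: "w \<in> reduced_words I G \<Longrightarrow> w = [] \<or> (\<exists>i\<in>I. starts_in i w)"
  by (cases w) (auto simp: reduced_words_Cons starts_in_def)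

lemma ends_in_factor:
  assumes "w \<in> reduced_words I G" shows "w = [] \<or> (\<exists>i\<in>I. ends_in i w)"
proof (cases "w = []")
  case False
  then have "last w \<in> set w" by simp
  then have "fst (last w) \<in> I" using assms unfolding reduced_words_def by fastforce
  then show ?thesis using False by (auto simp: ends_in_def)
qed simp

text \<open>
  Prescribing the last \<open>j\<close> steps to be \<open>s\<close> costs the factor \<open>pmf p s\<close> per step and moves the word
  length by at most \<open>\<sigma>\<close> per step.
\<close>

lemma padding:
  assumes p: "set_pmf p \<subseteq> carrier F" and s: "s \<in> set_pmf p"
  defines "\<sigma> \<equiv> len s + len (m_inv F s)" and "\<kappa> \<equiv> - ln (pmf p s)"
  shows "exp (- \<kappa> * real j) * measure_pmf.prob (conv_power F p m) {w. len w \<in> cball a d}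
           \<le> measure_pmf.prob (conv_power F p (m + j)) {w. len w \<in> cball a (d + \<sigma> * real j)}"
proof (induction j)
  case (Suc j)
  have "pmf p s > 0" using s by (simp add: pmf_positive)
  then have \<kappa>: "exp (- \<kappa>) = pmf p s" by (simp add: \<kappa>_def)
  have "measure_pmf.prob (conv_power F p (m + j)) {w. len w \<in> cball a (d + \<sigma> * real j)}
      * measure_pmf.prob (conv_power F p 1) {s}
      \<le> measure_pmf.prob (conv_power F p (m + j + 1)) {w. len w \<in> cball a (d + \<sigma> * real (Suc j))}"
  proof (rule F.conv_power_prob_mult[OF p])
    fix u v assume uv: "u \<in> {w. len w \<in> cball a (d + \<sigma> * real j)}" "v \<in> {s}" "u \<in> carrier F" "v \<in> carrier F"
    have "\<bar>len (u \<otimes>\<^bsub>F\<^esub> s) - len u\<bar> \<le> \<sigma>"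
      using word_length_right_mult[of u s] uv unfolding \<sigma>_def by simp
    then show "u \<otimes>\<^bsub>F\<^esub> v \<in> {w. len w \<in> cball a (d + \<sigma> * real (Suc j))}"
      using uv by (simp add: dist_real_def algebra_simps)
  qed
  also have "measure_pmf.prob (conv_power F p 1) {s} = exp (- \<kappa>)"
    unfolding F.conv_power_1[OF p] \<kappa> by (simp add: measure_pmf_single)
  finally have step: "exp (- \<kappa>) * measure_pmf.prob (conv_power F p (m + j)) {w. len w \<in> cball a (d + \<sigma> * real j)}
      \<le> measure_pmf.prob (conv_power F p (m + Suc j)) {w. len w \<in> cball a (d + \<sigma> * real (Suc j))}"
    by (simp only: mult.commute add.assoc Suc_eq_plus1)
  have "exp (- \<kappa> * real (Suc j)) = exp (- \<kappa>) * exp (- \<kappa> * real j)"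
    by (simp add: exp_add [symmetric] algebra_simps)
  then show ?case
    using order_trans[OF mult_left_mono[OF Suc.IH, of "exp (- \<kappa>)"] step] by (simp add: mult.assoc)
qed simp

text \<open>
  The empty word has no first or last factor and is counted for every \<open>i\<close>; it can be joined to any
  connecting word.
\<close>

lemma split_by_factor:
  assumes p: "set_pmf p \<subseteq> carrier F" and "I \<noteq> {}"
  shows "measure_pmf.prob (conv_power F p n) X
           \<le> (\<Sum>i\<in>I. measure_pmf.prob (conv_power F p n) {w\<in>X. w = [] \<or> ends_in i w})" (is ?ends)
    and "measure_pmf.prob (conv_power F p n) X
           \<le> (\<Sum>i\<in>I. measure_pmf.prob (conv_power F p n) {w\<in>X. w = [] \<or> starts_in i w})" (is ?starts)
proof -
  have "measure_pmf.prob (conv_power F p n) X \<le> (\<Sum>i\<in>I. measure_pmf.prob (conv_power F p n) {w\<in>X. w = [] \<or> P i w})"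
    if P: "\<And>w. w \<in> carrier F \<Longrightarrow> w = [] \<or> (\<exists>i\<in>I. P i w)" for P
  proof -
    have "measure_pmf.prob (conv_power F p n) X = measure_pmf.prob (conv_power F p n) (X \<inter> set_pmf (conv_power F p n))"
      by (simp add: measure_Int_set_pmf)
    also have "\<dots> \<le> measure_pmf.prob (conv_power F p n) (\<Union>i\<in>I. {w\<in>X. w = [] \<or> P i w})"
      using P F.set_conv_power[OF p, of n] \<open>I \<noteq> {}\<close> by (intro measure_pmf.finite_measure_mono) fastforce+
    also have "\<dots> \<le> (\<Sum>i\<in>I. measure_pmf.prob (conv_power F p n) {w\<in>X. w = [] \<or> P i w})"
      using finite_I by (intro measure_pmf.finite_measure_subadditive_finite) auto
    finally show ?thesis .
  qed
  then show ?ends ?starts using ends_in_factor starts_in_factor by simp_all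
qed

lemma concatenation:
  assumes p: "set_pmf p \<subseteq> carrier F"
    and f: "f \<in> set_pmf (conv_power F p k)" "f \<noteq> []" "\<not> starts_in i f" "\<not> ends_in j f"
  shows "measure_pmf.prob (conv_power F p m) {w. len w \<in> cball a d \<and> (w = [] \<or> ends_in i w)}
           * pmf (conv_power F p k) f
           * measure_pmf.prob (conv_power F p n) {w. len w \<in> cball b e \<and> (w = [] \<or> starts_in j w)}
         \<le> measure_pmf.prob (conv_power F p (m + k + n)) {w. len w \<in> cball (a + b) (d + e + len f)}"
    (is "measure_pmf.prob _ ?A * _ * measure_pmf.prob _ ?B \<le> measure_pmf.prob _ ?D")
proof -
  have "measure_pmf.prob (conv_power F p m) ?A * pmf (conv_power F p k) f
      \<le> measure_pmf.prob (conv_power F p (m + k)) ((\<lambda>u. u \<otimes>\<^bsub>F\<^esub> f) ` (?A \<inter> carrier F))"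
    unfolding measure_pmf_single [symmetric] by (rule F.conv_power_prob_mult[OF p]) auto
  then have "measure_pmf.prob (conv_power F p m) ?A * pmf (conv_power F p k) f * measure_pmf.prob (conv_power F p n) ?B
      \<le> measure_pmf.prob (conv_power F p (m + k)) ((\<lambda>u. u \<otimes>\<^bsub>F\<^esub> f) ` (?A \<inter> carrier F)) * measure_pmf.prob (conv_power F p n) ?B"
    by (rule mult_right_mono) simp
  also have "\<dots> \<le> measure_pmf.prob (conv_power F p (m + k + n)) ?D"
  proof (rule F.conv_power_prob_mult[OF p])
    fix w v
    assume "w \<in> (\<lambda>u. u \<otimes>\<^bsub>F\<^esub> f) ` (?A \<inter> carrier F)" and v: "v \<in> ?B" "v \<in> carrier F"
    then obtain u where u: "u \<in> ?A" "u \<in> carrier F" "w = u \<otimes>\<^bsub>F\<^esub> f" by blast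
    have "f \<in> carrier F" using F.set_conv_power[OF p] f(1) by blast
    then have "len (u \<otimes>\<^bsub>F\<^esub> f \<otimes>\<^bsub>F\<^esub> v) = len u + len f + len v"
      using word_length_connected[of u f v i j] u v f by simp
    then show "w \<otimes>\<^bsub>F\<^esub> v \<in> ?D"
      using u(1,3) v(1) by (auto simp: dist_real_def simp del: free_product_simps)
  qed
  finally show ?thesis .
qed

text \<open>
  The choice of the connecting word depends only on the last factor of \<open>u\<close> and the first factor of
  \<open>v\<close>, so the pairs \<open>(u, v)\<close> that use a given word form a product set and independence applies
  to each class separately. Sums over all pairs of factors serve as common bounds for the connecting
  times, lengths and costs.
\<close>

lemma approx_superadditive_word_length:
  assumes p: "set_pmf p \<subseteq> carrier F" and "I \<noteq> {}"
    and avoid: "\<And>i. i \<in> I \<Longrightarrow>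
      \<exists>g \<in> semigroup_generated F (set_pmf p). g \<noteq> \<one>\<^bsub>F\<^esub> \<and> \<not> starts_in i g \<and> \<not> ends_in i g"
  shows "\<exists>K C \<gamma> \<sigma> \<kappa>. approx_superadditive (\<lambda>n. map_pmf len (conv_power F p n)) K C \<gamma> \<sigma> \<kappa>"
proof -
  let ?P = "\<lambda>n. measure_pmf.prob (conv_power F p n)"
  have "\<exists>f k. f \<in> set_pmf (conv_power F p k) \<and> f \<noteq> [] \<and> \<not> starts_in i f \<and> \<not> ends_in j f"
    if "(i, j) \<in> I \<times> I" for i j
    using connecting_word[OF p avoid, of i j] F.semigroup_generated_conv_power[OF p] that by blast
  then have "\<forall>z\<in>I \<times> I. \<exists>f k. f \<in> set_pmf (conv_power F p k) \<and> f \<noteq> [] \<and>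
      \<not> starts_in (fst z) f \<and> \<not> ends_in (snd z) f"
    by (metis prod.collapse)
  then obtain f k where f: "\<And>z. z \<in> I \<times> I \<Longrightarrow> f z \<in> set_pmf (conv_power F p (k z)) \<and> f z \<noteq> [] \<and>
      \<not> starts_in (fst z) (f z) \<and> \<not> ends_in (snd z) (f z)"
    by metis
  obtain s where s: "s \<in> set_pmf p" using set_pmf_not_empty[of p] by blast
  define \<sigma> \<kappa> where "\<sigma> = len s + len (m_inv F s)" and "\<kappa> = - ln (pmf p s)"
  define \<theta> where "\<theta> z = - ln (pmf (conv_power F p (k z)) (f z))" for z
  define K where "K = (\<Sum>z\<in>I \<times> I. k z)"
  define C where "C = (\<Sum>z\<in>I \<times> I. len (f z)) + \<sigma> * real K"
  define \<gamma>' where "\<gamma>' = (\<Sum>z\<in>I \<times> I. \<theta> z) + \<kappa> * real K"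
  \<comment> \<open>The logarithm accounts for the number of pairs of factors over which the estimate is summed.\<close>
  define \<gamma> where "\<gamma> = ln (real (card (I \<times> I))) + \<gamma>'"
  have fin: "finite (I \<times> I)" using finite_I by simp
  have card: "card (I \<times> I) > 0" using fin \<open>I \<noteq> {}\<close> by (simp add: card_gt_0_iff)
  have \<sigma>0: "\<sigma> \<ge> 0" by (simp add: \<sigma>_def)
  have \<kappa>0: "\<kappa> \<ge> 0" using s by (simp add: \<kappa>_def pmf_le_1 pmf_positive)
  have \<theta>0: "\<theta> z \<ge> 0" if "z \<in> I \<times> I" for z
    using f[OF that] by (simp add: \<theta>_def pmf_le_1 pmf_positive)
  have le: "k z \<le> K" "len (f z) \<le> (\<Sum>z\<in>I \<times> I. len (f z))" "\<theta> z \<le> (\<Sum>z\<in>I \<times> I. \<theta> z)" if "z \<in> I \<times> I" for z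
    unfolding K_def using that fin \<theta>0 by (auto intro!: member_le_sum)
  have connect: "?P m {w\<in>{w. len w \<in> cball a d}. w = [] \<or> ends_in i w} *
        ?P n {w\<in>{w. len w \<in> cball b e}. w = [] \<or> starts_in j w}
      \<le> exp \<gamma>' * ?P (m + n + K) {w. len w \<in> cball (a + b) (d + e + C)}" (is "?p * ?q \<le> _ * ?D")
    if "i \<in> I" "j \<in> I" for m n a b d e i j
  proof -
    define z where "z = (i, j)"
    have z: "z \<in> I \<times> I" using that by (simp add: z_def)
    have "exp (- \<theta> z) = pmf (conv_power F p (k z)) (f z)"
      using f[OF z] by (simp add: \<theta>_def pmf_positive)
    then have "?p * exp (- \<theta> z) * ?q
        \<le> ?P (m + k z + n) {w. len w \<in> cball (a + b) (d + e + len (f z))}"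
      using concatenation[OF p, of "f z" "k z" i j m a d n b e] f[OF z] by (simp add: z_def)
    then have "exp (- \<kappa> * real (K - k z)) * (?p * exp (- \<theta> z) * ?q)
        \<le> exp (- \<kappa> * real (K - k z)) * ?P (m + k z + n) {w. len w \<in> cball (a + b) (d + e + len (f z))}"
      by (rule mult_left_mono) simp
    also have "\<dots> \<le> ?P (m + k z + n + (K - k z)) {w. len w \<in> cball (a + b) (d + e + len (f z) + \<sigma> * real (K - k z))}"
      unfolding \<sigma>_def \<kappa>_def by (rule padding[OF p s])
    also have "m + k z + n + (K - k z) = m + n + K" using le(1)[OF z] by simp
    also have "?P (m + n + K) {w. len w \<in> cball (a + b) (d + e + len (f z) + \<sigma> * real (K - k z))} \<le> ?D"
    proof (rule measure_pmf.finite_measure_mono)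
      have "\<sigma> * real (K - k z) \<le> \<sigma> * real K" using \<sigma>0 by (intro mult_left_mono) auto
      then show "{w. len w \<in> cball (a + b) (d + e + len (f z) + \<sigma> * real (K - k z))}
          \<subseteq> {w. len w \<in> cball (a + b) (d + e + C)}"
        using le(2)[OF z] unfolding C_def by auto
    qed simp
    finally have *: "exp (- \<kappa> * real (K - k z)) * (?p * exp (- \<theta> z) * ?q) \<le> ?D" .
    have "\<kappa> * real (K - k z) \<le> \<kappa> * real K" using \<kappa>0 by (intro mult_left_mono) auto
    then have "\<gamma>' - \<kappa> * real (K - k z) - \<theta> z \<ge> 0" using le(3)[OF z] unfolding \<gamma>'_def by linarith
    then have "?p * ?q * 1 \<le> ?p * ?q * exp (\<gamma>' - \<kappa> * real (K - k z) - \<theta> z)"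
      by (intro mult_left_mono) auto
    also have "\<dots> = exp \<gamma>' * (exp (- \<kappa> * real (K - k z)) * (?p * exp (- \<theta> z) * ?q))"
      by (simp add: exp_diff exp_minus exp_add field_simps)
    also have "\<dots> \<le> exp \<gamma>' * ?D" using * by (intro mult_left_mono) auto
    finally show ?thesis by simp
  qed
  have concat: "exp (- \<gamma>) * ?P m {w. len w \<in> cball a d} * ?P n {w. len w \<in> cball b e}
      \<le> ?P (m + n + K) {w. len w \<in> cball (a + b) (d + e + C)}" (is "_ * ?p * ?q \<le> ?D") for m n a b d e
  proof -
    have "?p * ?q \<le> (\<Sum>i\<in>I. ?P m {w\<in>{w. len w \<in> cball a d}. w = [] \<or> ends_in i w}) *
        (\<Sum>j\<in>I. ?P n {w\<in>{w. len w \<in> cball b e}. w = [] \<or> starts_in j w})"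
      using \<open>I \<noteq> {}\<close> by (intro mult_mono split_by_factor[OF p] sum_nonneg) auto
    also have "\<dots> \<le> (\<Sum>i\<in>I. \<Sum>j\<in>I. exp \<gamma>' * ?D)"
      unfolding sum_product by (intro sum_mono connect)
    also have "\<dots> = real (card (I \<times> I)) * exp \<gamma>' * ?D"
      by (simp add: card_cartesian_product)
    also have "\<dots> = exp \<gamma> * ?D" using card by (simp add: \<gamma>_def exp_add)
    finally have "exp (- \<gamma>) * (?p * ?q) \<le> exp (- \<gamma>) * (exp \<gamma> * ?D)" by (intro mult_left_mono) auto
    then show ?thesis by (simp add: exp_minus mult.assoc [symmetric])
  qed
  have \<gamma>'0: "\<gamma>' \<ge> 0"
    unfolding \<gamma>'_def using \<theta>0 \<kappa>0 by (intro add_nonneg_nonneg sum_nonneg) auto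
  have "approx_superadditive (\<lambda>n. map_pmf len (conv_power F p n)) K C \<gamma> \<sigma> \<kappa>"
  proof
    show "0 \<le> C" unfolding C_def using \<sigma>0 by (intro add_nonneg_nonneg sum_nonneg) auto
    show "0 \<le> \<gamma>" unfolding \<gamma>_def using \<gamma>'0 card by (intro add_nonneg_nonneg) auto
    show "map_pmf len (conv_power F p 0) = return_pmf 0"
      using word_length_one[of F SF] by simp
  qed (use \<sigma>0 \<kappa>0 concat padding[OF p s] in \<open>simp_all add: vimage_def \<sigma>_def \<kappa>_def\<close>)
  then show ?thesis by blast
qed

end

section \<open>The weak large deviation principle for the walk\<close>

lemma space_borel_on [simp]: "space (borel_on T) = topspace T"
  unfolding borel_on_def by (rule space_measure_of) (auto dest: openin_subset)

lemma openin_borel_on: "openin T U \<Longrightarrow> U \<in> sets (borel_on T)"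
  unfolding borel_on_def by (subst sets_measure_of) (auto dest: openin_subset)

lemma closedin_borel_on:
  assumes "closedin T U" shows "U \<in> sets (borel_on T)"
proof -
  have "space (borel_on T) - (topspace T - U) \<in> sets (borel_on T)"
    using assms by (intro sets.compl_sets openin_borel_on) auto
  moreover have "space (borel_on T) - (topspace T - U) = U"
    using closedin_subset[OF assms] by auto
  ultimately show ?thesis by simp
qed

theorem proposition1p3:
  fixes r :: nat
    and G :: "nat \<Rightarrow> ('a, 'b) monoid_scheme"
    and S :: "nat \<Rightarrow> 'a set"
    and \<mu> :: "(nat \<times> 'a) list measure"
    and M :: "'w measure"
    and Y :: "nat \<Rightarrow> 'w \<Rightarrow> (nat \<times> 'a) list"
  defines "F \<equiv> free_product {1..r} G"
    and "SF \<equiv> (\<Union>i\<in>{1..r}. factor_embed G i ` S i)"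
  assumes "r \<ge> 2"
    and "\<And>i. i \<in> {1..r} \<Longrightarrow> group (G i)"
    and "\<And>i. i \<in> {1..r} \<Longrightarrow> carrier (G i) \<noteq> {\<one>\<^bsub>G i\<^esub>}"
    and "\<And>i. i \<in> {1..r} \<Longrightarrow> finite (S i)"
    and "\<And>i. i \<in> {1..r} \<Longrightarrow> S i \<subseteq> carrier (G i)"
    and "\<And>i. i \<in> {1..r} \<Longrightarrow> generate (G i) (S i) = carrier (G i)"
    and "prob_space \<mu>"
    and "sets \<mu> = Pow (carrier F)"
    and "\<And>i. i \<in> {1..r} \<Longrightarrow>
          \<exists>g \<in> semigroup_generated F (measure_support \<mu>). g \<noteq> \<one>\<^bsub>F\<^esub> \<and> \<not> starts_in i g \<and> \<not> ends_in i g"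
    and "prob_space M"
    and "right_random_walk M F \<mu> Y"
  shows "\<exists>I :: real \<Rightarrow> ereal.
           weak_LDP M (top_of_set {0..}) (\<lambda>n \<omega>. real (word_length F SF (Y n \<omega>)) / real n) I \<and>
           ereal_convex_on {0..} I"
proof -
  have r1: "1 \<in> {1..r}" using \<open>r \<ge> 2\<close> by simp
  interpret FP: fg_free_product "{1..r}" G S
    using assms(4,6,7,8) by (intro fg_free_product.intro) auto
  note FF = F_def SF_def
  interpret \<mu>: prob_space \<mu> by fact
  interpret M: prob_space M by fact
  have sets\<mu>: "sets \<mu> = Pow (carrier F)" by fact
  have sp: "space \<mu> = carrier F" using sets_eq_imp_space_eq[of \<mu> "count_space (carrier F)"] sets\<mu> by simp
  have count: "countable (carrier F)" unfolding F_def by (rule FP.countable_carrier)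
  obtain p where p: "measure_pmf p = distr \<mu> (count_space UNIV) (\<lambda>x. x)"
    using \<mu>.distr_pmf[OF sets\<mu> count] .
  have id: "(\<lambda>x. x) \<in> \<mu> \<rightarrow>\<^sub>M count_space UNIV"
    by (rule measurableI) (auto simp: sets\<mu> sp)
  have pmf: "pmf p g = (if g \<in> carrier F then measure \<mu> {g} else 0)" for g
  proof -
    have "pmf p g = measure \<mu> ({g} \<inter> carrier F)"
      unfolding pmf.rep_eq p using measure_distr[OF id, of "{g}"] by (simp add: sp vimage_def Int_def)
    then show ?thesis by (cases "g \<in> carrier F") simp_all
  qed
  have supp: "set_pmf p = measure_support \<mu>"
    unfolding set_eq_iff set_pmf_iff pmf measure_support_def sp
    by (auto simp: less_le split: if_splits)
  have pF: "set_pmf p \<subseteq> carrier F" unfolding supp measure_support_def sp by blast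
  have law: "Y n \<in> M \<rightarrow>\<^sub>M \<mu>" "distr M (count_space UNIV) (Y n) = measure_pmf (conv_power F p n)" for n
    using FP.F.random_walk_law[folded F_def, OF \<open>prob_space M\<close> \<open>prob_space \<mu>\<close> sets\<mu> count p
        \<open>right_random_walk M F \<mu> Y\<close>, of n] by auto
  obtain K C \<gamma> \<sigma> \<kappa> where
    "approx_superadditive (\<lambda>n. map_pmf (\<lambda>w. real (word_length F SF w)) (conv_power F p n)) K C \<gamma> \<sigma> \<kappa>"
    using FP.approx_superadditive_word_length[of p, folded FF] pF r1 assms(11)[folded supp] by blast
  then interpret L: approx_superadditive "\<lambda>n. map_pmf (\<lambda>w. real (word_length F SF w)) (conv_power F p n)" K C \<gamma> \<sigma> \<kappa> .
  let ?T = "top_of_set {0::real..}"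
  let ?Z = "\<lambda>n \<omega>. real (word_length F SF (Y n \<omega>)) / real n"
  let ?Q = "\<lambda>n. map_pmf (\<lambda>w. real (word_length F SF w)) (conv_power F p n)"
  have Zm: "?Z n \<in> M \<rightarrow>\<^sub>M borel_on ?T" for n
  proof -
    have "(\<lambda>w. real (word_length F SF w) / real n) \<in> \<mu> \<rightarrow>\<^sub>M borel_on ?T"
      by (rule measurableI) (auto simp: sets\<mu> sp)
    from measurable_compose[OF law(1) this] show ?thesis .
  qed
  have Zlaw: "measure (distr M (borel_on ?T) (?Z n)) V = measure_pmf.prob (?Q n) {s. s / real n \<in> V}"
    if "V \<in> sets (borel_on ?T)" for n V
  proof -
    have "measure (distr M (borel_on ?T) (?Z n)) V = measure M (?Z n -` V \<inter> space M)"
      using Zm that by (rule measure_distr)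
    also have "?Z n -` V \<inter> space M = Y n -` {w. real (word_length F SF w) / real n \<in> V} \<inter> space M"
      by auto
    also have "measure M \<dots> = measure (distr M (count_space UNIV) (Y n)) {w. real (word_length F SF w) / real n \<in> V}"
      using measurable_compose[OF law(1) id] by (intro measure_distr [symmetric]) auto
    also have "\<dots> = measure_pmf.prob (?Q n) {s. s / real n \<in> V}"
      by (simp add: law(2) vimage_def)
    finally show ?thesis .
  qed
  have "weak_LDP M ?T ?Z L.rate"
    unfolding weak_LDP_def
  proof (intro conjI allI impI ballI)
    show "?Z n \<in> M \<rightarrow>\<^sub>M borel_on ?T" for n by (rule Zm)
    show "0 \<le> L.rate x" for x by (rule L.rate_nonneg)
    have "{x \<in> topspace ?T. a < L.rate x} = {0..} \<inter> {x. a < L.rate x}" for a by auto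
    then show "lower_semicontinuous_map ?T L.rate"
      unfolding lower_semicontinuous_map_def using L.open_rate_greater by (simp add: openin_open_Int)
  next
    fix V assume V: "openin ?T V"
    then obtain U where U: "open U" "V = {0..} \<inter> U" by (auto simp: openin_open)
    let ?f = "\<lambda>n. ereal (1 / real n) * ext_log (measure (distr M (borel_on ?T) (?Z n)) V)"
    have "measure (distr M (borel_on ?T) (?Z n)) V = measure_pmf.prob (?Q n) {s. s / real n \<in> U}" for n
      unfolding Zlaw[OF openin_borel_on[OF V]] by (simp add: U(2) vimage_def)
    then have "- L.rate x \<le> liminf ?f" if "x \<in> V" for x
      using L.lower_bound[OF U(1), of x] that U(2) by simp
    then have "- liminf ?f \<le> (INF x\<in>V. L.rate x)"
      by (intro INF_greatest) (rule iffD1[OF ereal_uminus_le_reorder])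
    then show "- (INF x\<in>V. L.rate x) \<le> liminf ?f" by (rule iffD1[OF ereal_uminus_le_reorder])
  next
    fix A assume "compactin ?T A"
    then have A: "compact A" "A \<subseteq> {0..}" by (auto simp: compactin_subtopology)
    then have "closedin ?T A" by (intro closed_subset compact_imp_closed)
    then show "limsup (\<lambda>n. ereal (1 / real n) * ext_log (measure (distr M (borel_on ?T) (?Z n)) A))
        \<le> - (INF x\<in>A. L.rate x)"
      using L.upper_bound[OF A(1)] by (simp only: Zlaw[OF closedin_borel_on])
  qed
  moreover have "ereal_convex_on {0..} L.rate"
    unfolding ereal_convex_on_def using L.rate_convex by auto
  ultimately show ?thesis by blast
qed

end
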